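(* Let $m\ge0$. Then $A_m^{(2)}$ is a free $\mathcal D_2$-module with basis $\{1\}\sqcup\{\delta_{2;m}(x_1^{s(q-1)}) : 2\le s\le q\}$. Moreover, the $\mathcal D_2$-module $\mathcal M=\Big\{\dfrac{f(x_1,x_2)-f(x_1+x_2,x_2)}{x_2^{q^m}} : f\in A_m^{(2)}\Big\}$ does not depend on $m$, and it is the free $\mathcal D_2$-module with basis $$\Big\{\frac{x_1^{s(q-1)+1}+x_2^{s(q-1)+1}-(x_1+x_2)^{s(q-1)+1}}{x_1x_2^q-x_2x_1^q} : 2\le s\le q\Big\}.$$
   Context: $q$ is a power of a prime. Delta operators: for integers $b\ge0$, $c\ge0$, $1\le a\le c+1$, $\delta_{a;b}:\mathbb{F}_q(x_1,\dots,x_c)\to\mathbb{F}_q(x_1,\dots,x_{c+1})$ sends $f$ to $N/L(x_1,\dots,x_a)$, where $N$ is the $a\times a$ determinant whose $t$-th row is $(x_1^{q^{t-1}},\dots,x_a^{q^{t-1}})$ for $t=1,\dots,a-1$ and whose last row is $(x_1^{q^b}f(\hat x_1),\dots,x_a^{q^b}f(\hat x_a))$, with $f(\hat x_i)=f(x_1,\dots,x_{i-1},x_{i+1},\dots,x_{c+1})$, and $L(x_1,\dots,x_a)=\det(x_j^{q^{t-1}})_{1\le t,j\le a}$. (Here $\delta_{2;m}$ is applied with $c=1$.) For $n\ge1$, $A_m^{(n)}$ is the set of $f\in\mathbb{F}_q[x_1,\dots,x_n]$ such that $\delta_{n+1;m}(f)$ (with $c=n$) is a polynomial. Dickson invariants: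 $\prod_{v\in\mathrm{span}_{\mathbb{F}_q}\{x_1,\dots,x_n\}}(X+v)=\sum_{i=0}^n(-1)^{n-i}Q_{n,i}X^{q^i}$ with $Q_{n,n}=1$; $\mathcal D_n=\mathbb{F}_q[Q_{n,0},\dots,Q_{n,n-1}]$ (the $GL_n(\mathbb{F}_q)$-invariants); $A_m^{(n)}$ is a $\mathcal D_n$-module under multiplication. *)

theory Defs
  imports "HOL-Computational_Algebra.Polynomial" "HOL-Library.Cardinality"
begin

text \<open>Multivariate polynomials over F_q are modelled as nested univariate polynomials.
  Two variables: type 'a poly poly, x1 = inner variable, x2 = outer variable.
  Three variables: type 'a poly poly poly, x1 innermost, x3 outermost.
  F_q is a finite field type 'a with q = CARD('a).\<close>

definition ev1 :: "('a::comm_ring_1 \<Rightarrow> 'b::comm_ring_1) \<Rightarrow> 'a poly \<Rightarrow> 'b \<Rightarrow> 'b" where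
  "ev1 \<phi> g u = poly (map_poly \<phi> g) u"

definition ev2 :: "('a::comm_ring_1 \<Rightarrow> 'b::comm_ring_1) \<Rightarrow> 'a poly poly \<Rightarrow> 'b \<Rightarrow> 'b \<Rightarrow> 'b" where
  "ev2 \<phi> f u v = poly (map_poly (\<lambda>c. ev1 \<phi> c u) f) v"

definition C2 :: "'a::comm_ring_1 \<Rightarrow> 'a poly poly" where "C2 c = [:[:c:]:]"
definition C3 :: "'a::comm_ring_1 \<Rightarrow> 'a poly poly poly" where "C3 c = [:[:[:c:]:]:]"

definition X1 :: "'a::comm_ring_1 poly poly" where "X1 = [:[:0, 1:]:]"
definition X2 :: "'a::comm_ring_1 poly poly" where "X2 = [:0, 1:]"

definition Y1 :: "'a::comm_ring_1 poly poly poly" where "Y1 = [:[:[:0, 1:]:]:]"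
definition Y2 :: "'a::comm_ring_1 poly poly poly" where "Y2 = [:[:0, 1:]:]"
definition Y3 :: "'a::comm_ring_1 poly poly poly" where "Y3 = [:0, 1:]"

definition det2 :: "'b::comm_ring_1 \<Rightarrow> 'b \<Rightarrow> 'b \<Rightarrow> 'b \<Rightarrow> 'b" where
  "det2 a1 a2 b1 b2 = a1 * b2 - a2 * b1"

definition det3 :: "'b::comm_ring_1 \<Rightarrow> 'b \<Rightarrow> 'b \<Rightarrow> 'b \<Rightarrow> 'b \<Rightarrow> 'b \<Rightarrow> 'b \<Rightarrow> 'b \<Rightarrow> 'b \<Rightarrow> 'b" where
  "det3 a1 a2 a3 b1 b2 b3 c1 c2 c3 =
     a1 * (b2 * c3 - b3 * c2) - a2 * (b1 * c3 - b3 * c1) + a3 * (b1 * c2 - b2 * c1)"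

definition L2 :: "'a::{finite,field} poly poly" where
  "L2 = det2 X1 X2 (X1 ^ CARD('a)) (X2 ^ CARD('a))"

definition L3 :: "'a::{finite,field} poly poly poly" where
  "L3 = det3 Y1 Y2 Y3 (Y1 ^ CARD('a)) (Y2 ^ CARD('a)) (Y3 ^ CARD('a))
          (Y1 ^ (CARD('a)^2)) (Y2 ^ (CARD('a)^2)) (Y3 ^ (CARD('a)^2))"

definition delta2_num :: "nat \<Rightarrow> 'a::{finite,field} poly \<Rightarrow> 'a poly poly" where
  "delta2_num m g = det2 X1 X2
      (X1 ^ (CARD('a)^m) * ev1 C2 g X2) (X2 ^ (CARD('a)^m) * ev1 C2 g X1)"

definition delta2 :: "nat \<Rightarrow> 'a::{finite,field} poly \<Rightarrow> 'a poly poly" where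
  "delta2 m g = delta2_num m g div L2"

definition delta3_num :: "nat \<Rightarrow> 'a::{finite,field} poly poly \<Rightarrow> 'a poly poly poly" where
  "delta3_num m f = det3 Y1 Y2 Y3 (Y1 ^ CARD('a)) (Y2 ^ CARD('a)) (Y3 ^ CARD('a))
      (Y1 ^ (CARD('a)^m) * ev2 C3 f Y2 Y3)
      (Y2 ^ (CARD('a)^m) * ev2 C3 f Y1 Y3)
      (Y3 ^ (CARD('a)^m) * ev2 C3 f Y1 Y2)"

text \<open>A_m^{(2)}: delta_{3;m}(f) = N/L is a polynomial, i.e. L divides N.\<close>
definition A2 :: "nat \<Rightarrow> 'a::{finite,field} poly poly set" where
  "A2 m = {f. L3 dvd delta3_num m f}"

text \<open>Dickson invariants for n = 2: prod_{v in span(x1,x2)} (X + v) in (F_q[x1,x2])[X],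
  Q_{2,i} = (-1)^(2-i) * coefficient of X^(q^i).\<close>
definition span2 :: "'a::{finite,field} poly poly set" where
  "span2 = {C2 a * X1 + C2 b * X2 | a b. True}"

definition dickson_prod :: "'a::{finite,field} poly poly poly" where
  "dickson_prod = (\<Prod>v\<in>span2. [:v, 1:])"

definition dickson2 :: "nat \<Rightarrow> 'a::{finite,field} poly poly" where
  "dickson2 i = (-1) ^ (2 - i) * coeff dickson_prod (CARD('a) ^ i)"

definition D2 :: "'a::{finite,field} poly poly set" where
  "D2 = {ev2 C2 h (dickson2 0) (dickson2 1) | h. True}"

definition D2_free_basis :: "'a::{finite,field} poly poly set \<Rightarrow> nat set \<Rightarrow> (nat \<Rightarrow> 'a poly poly) \<Rightarrow> bool" where
  "D2_free_basis M I B \<longleftrightarrow> finite I \<and>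
     M = {\<Sum>i\<in>I. c i * B i | c. \<forall>i\<in>I. c i \<in> D2} \<and>
     (\<forall>c c'. (\<forall>i\<in>I. c i \<in> D2 \<and> c' i \<in> D2) \<longrightarrow>
        (\<Sum>i\<in>I. c i * B i) = (\<Sum>i\<in>I. c' i * B i) \<longrightarrow> (\<forall>i\<in>I. c i = c' i))"

definition Mset :: "nat \<Rightarrow> 'a::{finite,field} poly poly set" where
  "Mset m = {(f - ev2 C2 f (X1 + X2) X2) div X2 ^ (CARD('a) ^ m) | f. f \<in> A2 m}"

definition Mnum :: "nat \<Rightarrow> 'a::{finite,field} poly poly" where
  "Mnum s = X1 ^ (s * (CARD('a) - 1) + 1) + X2 ^ (s * (CARD('a) - 1) + 1)
            - (X1 + X2) ^ (s * (CARD('a) - 1) + 1)"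

end

theory Submission
  imports Defs
begin

text \<open>Put \<open>Q = q^m\<close>, \<open>F = f L\<^sub>2\<close> and \<open>V = span(x\<^sub>1, x\<^sub>2)\<close>. Factoring \<open>L\<^sub>3\<close> into linear forms, \<open>f\<close> lies in
  \<open>A\<^sub>m\<close> iff \<open>v^Q F(u,w) = u^Q F(v,w) + w^Q F(u,v)\<close> for all \<open>u, v, w\<close> in \<open>V\<close>. This makes \<open>F\<close> of the form
  \<open>v^Q G(u) - u^Q G(v)\<close>, and \<open>f(x\<^sub>1,x\<^sub>2) - f(x\<^sub>1+x\<^sub>2,x\<^sub>2) = x\<^sub>2^Q h\<close> with
  \<open>h L\<^sub>2 = G(x\<^sub>1) + G(x\<^sub>2) - G(x\<^sub>1+x\<^sub>2)\<close>. The kernel of \<open>f \<mapsto> h\<close> consists of the invariants of \<open>GL\<^sub>2\<close>, that is,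
  of \<open>D\<^sub>2\<close> by Dickson's theorem, and \<open>\<delta>(x^(s(q-1)))\<close> is mapped to the \<open>s\<close>-th basis element of \<open>M\<close>
  because it corresponds to \<open>G(u) = u^(s(q-1)+1)\<close>.

  Interpolating \<open>G\<close> on the \<open>q^2\<close> points of \<open>V\<close> expresses it by powers \<open>u^(s(q-1)+1)\<close> with \<open>0 \<le> s \<le> q\<close>.
  The powers with \<open>s \<le> 1\<close> are additive and do not contribute to \<open>h\<close>; the other coefficients are
  unique, hence invariant under \<open>GL\<^sub>2\<close>. With \<open>z = x\<^sub>2^q - x\<^sub>1^(q-1) x\<^sub>2\<close>, their denominators divide \<open>z^(q-1)\<close>,
  and \<open>x\<^sub>1^(q-1) z^(q-1)\<close> is the invariant \<open>Q\<^sub>2\<^sub>,\<^sub>0\<close>. Since an invariant divisible by \<open>x\<^sub>1\<close> is divisible by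
  \<open>Q\<^sub>2\<^sub>,\<^sub>0\<close>, the coefficients are polynomials.\<close>

section \<open>Ring homomorphisms and substitution\<close>

text \<open>Unital ring homomorphisms as a plain predicate: every evaluation, coefficient map and
  substitution on the nested polynomial rings satisfies it, so one set of rules serves them
  all.\<close>

definition rhom :: "('r::comm_ring_1 \<Rightarrow> 's::comm_ring_1) \<Rightarrow> bool" where
  "rhom \<phi> \<longleftrightarrow> \<phi> 0 = 0 \<and> \<phi> 1 = 1 \<and> (\<forall>x y. \<phi> (x + y) = \<phi> x + \<phi> y) \<and> (\<forall>x y. \<phi> (x * y) = \<phi> x * \<phi> y)"

lemma rhomI:
  assumes "\<phi> 0 = 0" "\<phi> 1 = 1" "\<And>x y. \<phi> (x + y) = \<phi> x + \<phi> y" "\<And>x y. \<phi> (x * y) = \<phi> x * \<phi> y"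
  shows "rhom \<phi>"
  using assms by (simp add: rhom_def)

lemma rhom_0: "rhom \<phi> \<Longrightarrow> \<phi> 0 = 0"
  and rhom_1: "rhom \<phi> \<Longrightarrow> \<phi> 1 = 1"
  and rhom_add: "rhom \<phi> \<Longrightarrow> \<phi> (x + y) = \<phi> x + \<phi> y"
  and rhom_mult: "rhom \<phi> \<Longrightarrow> \<phi> (x * y) = \<phi> x * \<phi> y"
  by (simp_all add: rhom_def)

lemma rhom_uminus:
  assumes "rhom \<phi>"
  shows "\<phi> (- x) = - \<phi> x"
  using rhom_add[OF assms, of x "- x"] rhom_0[OF assms] by (simp add: eq_neg_iff_add_eq_0 add.commute)

lemma rhom_diff:
  assumes "rhom \<phi>"
  shows "\<phi> (x - y) = \<phi> x - \<phi> y"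
  using rhom_add[OF assms, of x "- y"] by (simp add: rhom_uminus[OF assms])

lemma rhom_power:
  assumes "rhom \<phi>"
  shows "\<phi> (x ^ n) = \<phi> x ^ n"
  by (induction n) (simp_all add: rhom_1[OF assms] rhom_mult[OF assms])

lemma rhom_sum:
  assumes "rhom \<phi>"
  shows "\<phi> (\<Sum>i\<in>I. h i) = (\<Sum>i\<in>I. \<phi> (h i))"
  by (induction I rule: infinite_finite_induct) (simp_all add: rhom_0[OF assms] rhom_add[OF assms])

lemma rhom_prod:
  assumes "rhom \<phi>"
  shows "\<phi> (\<Prod>i\<in>I. h i) = (\<Prod>i\<in>I. \<phi> (h i))"
  by (induction I rule: infinite_finite_induct) (simp_all add: rhom_1[OF assms] rhom_mult[OF assms])

lemmas rhom_simps = rhom_0 rhom_1 rhom_add rhom_mult rhom_uminus rhom_diff rhom_power rhom_sum rhom_prod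

lemma rhom_dvd: "rhom \<phi> \<Longrightarrow> x dvd y \<Longrightarrow> \<phi> x dvd \<phi> y"
  unfolding dvd_def using rhom_mult by blast

lemma rhom_eq_0_iff:
  fixes \<phi> :: "'f::field \<Rightarrow> 's::comm_ring_1"
  assumes "rhom \<phi>"
  shows "\<phi> x = 0 \<longleftrightarrow> x = 0"
proof
  assume *: "\<phi> x = 0"
  show "x = 0"
  proof (rule ccontr)
    assume "x \<noteq> 0"
    then have "\<phi> 1 = \<phi> x * \<phi> (inverse x)" by (simp flip: rhom_mult[OF assms])
    then show False using * rhom_1[OF assms] by simp
  qed
qed (simp add: rhom_0[OF assms])

lemma rhom_inj:
  fixes \<phi> :: "'f::field \<Rightarrow> 's::comm_ring_1"
  assumes "rhom \<phi>"
  shows "\<phi> x = \<phi> y \<longleftrightarrow> x = y"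
  using rhom_eq_0_iff[OF assms, of "x - y"] rhom_diff[OF assms, of x y] by auto

lemma rhom_comp: "rhom \<phi> \<Longrightarrow> rhom \<psi> \<Longrightarrow> rhom (\<lambda>x. \<psi> (\<phi> x))"
  by (auto simp: rhom_def)

lemma rhom_id: "rhom (\<lambda>x. x)"
  by (auto simp: rhom_def)

lemma rhom_const_poly: "rhom (\<lambda>c. [:c:])"
  by (auto simp: rhom_def one_pCons)

lemma rhom_C2: "rhom C2"
  by (auto simp: rhom_def C2_def one_pCons)

lemma rhom_C3: "rhom C3"
  by (auto simp: rhom_def C3_def one_pCons)

lemma rhom_poly: "rhom (\<lambda>p. poly p x)"
  by (auto simp: rhom_def)

lemma rhom_map_poly:
  assumes "rhom \<phi>"
  shows "rhom (map_poly \<phi>)"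
proof (rule rhomI)
  show "map_poly \<phi> 0 = 0" "map_poly \<phi> 1 = 1"
    by (simp_all add: rhom_1[OF assms] rhom_0[OF assms])
  show "map_poly \<phi> (p + r) = map_poly \<phi> p + map_poly \<phi> r" for p r
    by (rule poly_eqI) (simp add: coeff_map_poly rhom_simps[OF assms])
  show "map_poly \<phi> (p * r) = map_poly \<phi> p * map_poly \<phi> r" for p r
    by (rule poly_eqI) (simp add: coeff_map_poly rhom_simps[OF assms] coeff_mult)
qed

lemma rhom_ev1: "rhom \<phi> \<Longrightarrow> rhom (\<lambda>g. ev1 \<phi> g u)"
  unfolding ev1_def by (rule rhom_comp[OF rhom_map_poly rhom_poly])

lemma rhom_ev2: "rhom \<phi> \<Longrightarrow> rhom (\<lambda>f. ev2 \<phi> f u v)"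
  unfolding ev2_def by (rule rhom_comp[OF rhom_map_poly[OF rhom_ev1] rhom_poly])

text \<open>Universal property of a polynomial ring. It later reduces the comparison of two
  substitutions to constants and variables.\<close>

lemma rhom_eq_eval:
  fixes \<theta> :: "'r::comm_ring_1 poly \<Rightarrow> 's::comm_ring_1"
  assumes "rhom \<theta>"
  shows "\<theta> p = poly (map_poly (\<lambda>c. \<theta> [:c:]) p) (\<theta> [:0, 1:])"
proof (induction p)
  case 0
  show ?case using rhom_0[OF assms] by simp
next
  case (pCons a p)
  have "pCons a p = [:a:] + [:0, 1:] * p" by simp
  then have "\<theta> (pCons a p) = \<theta> [:a:] + \<theta> [:0, 1:] * \<theta> p"
    by (simp only: rhom_add[OF assms] rhom_mult[OF assms])
  then show ?case using pCons rhom_0[OF assms]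
    by (subst map_poly_pCons) simp_all
qed

lemma rhom_eq_ev1:
  fixes \<theta> :: "'r::comm_ring_1 poly \<Rightarrow> 's::comm_ring_1"
  assumes "rhom \<theta>"
  shows "\<theta> g = ev1 (\<lambda>c. \<theta> [:c:]) g (\<theta> [:0, 1:])"
  unfolding ev1_def by (rule rhom_eq_eval[OF assms])

lemma rhom_eq_ev2:
  fixes \<theta> :: "'r::comm_ring_1 poly poly \<Rightarrow> 's::comm_ring_1"
  assumes "rhom \<theta>"
  shows "\<theta> f = ev2 (\<lambda>c. \<theta> (C2 c)) f (\<theta> X1) (\<theta> X2)"
proof -
  have "rhom (\<lambda>c. \<theta> [:c:])" by (rule rhom_comp[OF rhom_const_poly assms])
  from rhom_eq_ev1[OF this] have *: "(\<lambda>c. \<theta> [:c:]) = (\<lambda>c. ev1 (\<lambda>c. \<theta> (C2 c)) c (\<theta> X1))"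
    unfolding C2_def X1_def by (rule ext)
  show ?thesis
    unfolding ev2_def X2_def *[symmetric] by (rule rhom_eq_eval[OF assms])
qed

lemma ev1_C: "rhom \<phi> \<Longrightarrow> ev1 \<phi> [:c:] u = \<phi> c"
  by (simp add: ev1_def map_poly_pCons rhom_0[of \<phi>])

lemma ev1_X: "rhom \<phi> \<Longrightarrow> ev1 \<phi> [:0, 1:] u = u"
  by (simp add: ev1_def map_poly_pCons rhom_0[of \<phi>] rhom_1[of \<phi>])

lemma ev2_C2:
  assumes "rhom \<phi>"
  shows "ev2 \<phi> (C2 c) u v = \<phi> c"
  by (simp add: ev2_def C2_def map_poly_pCons ev1_C[OF assms] rhom_0[OF rhom_ev1[OF assms]])

lemma ev2_X1:
  assumes "rhom \<phi>"
  shows "ev2 \<phi> X1 u v = u"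
  by (simp add: ev2_def X1_def map_poly_pCons ev1_X[OF assms] rhom_0[OF rhom_ev1[OF assms]])

lemma ev2_X2:
  assumes "rhom \<phi>"
  shows "ev2 \<phi> X2 u v = v"
  by (simp add: ev2_def X2_def map_poly_pCons rhom_0[OF rhom_ev1[OF assms]] rhom_1[OF rhom_ev1[OF assms]])

lemmas ev2_simps = ev2_C2 ev2_X1 ev2_X2 rhom_simps[OF rhom_ev2]

text \<open>The composite is again a homomorphism out of the two-variable ring, so it is read off
  from its values at the constants, \<open>X1\<close> and \<open>X2\<close>.\<close>

lemma rhom_ev2_apply:
  assumes "rhom \<psi>" "rhom \<phi>"
  shows "\<psi> (ev2 \<phi> f u v) = ev2 (\<lambda>c. \<psi> (\<phi> c)) f (\<psi> u) (\<psi> v)"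
  using rhom_eq_ev2[OF rhom_comp[OF rhom_ev2[OF assms(2)] assms(1)], of f u v]
  by (simp add: ev2_C2[OF assms(2)] ev2_X1[OF assms(2)] ev2_X2[OF assms(2)])

lemma rhom_eqI2:
  assumes "rhom \<theta>" "rhom \<theta>'" "\<And>c. \<theta> (C2 c) = \<theta>' (C2 c)" "\<theta> X1 = \<theta>' X1" "\<theta> X2 = \<theta>' X2"
  shows "\<theta> f = \<theta>' f"
  using rhom_eq_ev2[OF assms(1), of f] rhom_eq_ev2[OF assms(2), of f] assms(3-5) by simp

section \<open>Substitution in two and three variables\<close>

abbreviation sub :: "'a::comm_ring_1 poly poly \<Rightarrow> 'a poly poly \<Rightarrow> 'a poly poly \<Rightarrow> 'a poly poly" where
  "sub \<equiv> ev2 C2"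

lemma rhom_sub: "rhom (\<lambda>f. sub f u v)"
  by (rule rhom_ev2[OF rhom_C2])

lemmas sub_simps = ev2_simps[OF rhom_C2]

lemma sub_X1_X2: "sub f X1 X2 = f"
  using rhom_eq_ev2[OF rhom_id, of f] by simp

lemma sub_sub: "sub (sub f u v) u' v' = sub f (sub u u' v') (sub v u' v')"
  using rhom_ev2_apply[OF rhom_sub[of u' v'] rhom_C2, of f u v] by (simp add: sub_simps)

text \<open>Values stay in the two-variable ring because the points of interest are triples of
  linear forms in \<open>X1\<close> and \<open>X2\<close>.\<close>

definition ev3 :: "'a::comm_ring_1 poly poly poly \<Rightarrow> 'a poly poly \<Rightarrow> 'a poly poly \<Rightarrow> 'a poly poly \<Rightarrow> 'a poly poly" where
  "ev3 p u v w = poly (map_poly (\<lambda>r. sub r u v) p) w"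

lemma rhom_ev3: "rhom (\<lambda>p. ev3 p u v w)"
  unfolding ev3_def by (rule rhom_comp[OF rhom_map_poly[OF rhom_sub] rhom_poly])

lemma ev3_const: "ev3 [:r:] u v w = sub r u v"
  by (simp add: ev3_def map_poly_pCons sub_simps)

lemma C3_eq: "C3 c = [:C2 c:]" and Y1_eq: "Y1 = [:X1:]" and Y2_eq: "Y2 = [:X2:]"
  by (simp_all add: C3_def C2_def Y1_def X1_def Y2_def X2_def)

lemma ev3_C3: "ev3 (C3 c) u v w = C2 c"
  by (simp add: C3_eq ev3_const sub_simps)

lemma ev3_Y: "ev3 Y1 u v w = u" "ev3 Y2 u v w = v" "ev3 Y3 u v w = w"
  by (simp_all add: Y1_eq Y2_eq ev3_const sub_simps)
     (simp add: Y3_def ev3_def map_poly_pCons sub_simps)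

lemma ev3_ev2: "ev3 (ev2 C3 f y y') u v w = sub f (ev3 y u v w) (ev3 y' u v w)"
  using rhom_ev2_apply[OF rhom_ev3 rhom_C3, of f y y' u v w] by (simp add: ev3_C3)

lemmas ev3_simps = ev3_C3 ev3_Y ev3_ev2 rhom_simps[OF rhom_ev3]

section \<open>Finite fields\<close>

lemma poly_eq_0_by_roots:
  fixes p :: "'r::idom poly"
  assumes "finite S" "\<And>x. x \<in> S \<Longrightarrow> poly p x = 0" "degree p < card S"
  shows "p = 0"
proof (rule ccontr)
  assume p: "p \<noteq> 0"
  have "S \<subseteq> {x. poly p x = 0}" using assms(2) by blast
  with poly_roots_finite[OF p] have "card S \<le> card {x. poly p x = 0}" by (rule card_mono)
  also have "\<dots> \<le> degree p" by (rule card_poly_roots_bound[OF p])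
  finally show False using assms(3) by simp
qed

lemma prod_linear_dvd:
  fixes p :: "'r::idom poly"
  assumes "finite S" "\<And>x. x \<in> S \<Longrightarrow> poly p x = 0"
  shows "(\<Prod>x\<in>S. [:- x, 1:]) dvd p"
  using assms
proof (induction S arbitrary: p rule: finite_induct)
  case (insert x S)
  then obtain r where r: "p = [:- x, 1:] * r" using poly_eq_0_iff_dvd by blast
  have "poly r y = 0" if "y \<in> S" for y
  proof -
    have "x \<noteq> y" using that insert.hyps by blast
    moreover have "poly p y = 0" using insert.prems that by blast
    ultimately show ?thesis by (simp add: r)
  qed
  then have "(\<Prod>x\<in>S. [:- x, 1:]) dvd r" by (rule insert.IH)
  then show ?case using insert.hyps r by (simp add: mult_dvd_mono del: mult_pCons_left)
qed simp

lemma monic_degree_prod_linear: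
  "degree (\<Prod>x\<in>S. [:- x, 1::'r::idom:]) = card S \<and> lead_coeff (\<Prod>x\<in>S. [:- x, 1::'r:]) = 1"
proof -
  have "degree (\<Prod>x\<in>S. [:- x, 1::'r:]) = card S"
    by (induction S rule: infinite_finite_induct) (auto simp: degree_mult_eq simp del: mult_pCons_left)
  moreover have "lead_coeff (\<Prod>x\<in>S. [:- x, 1::'r:]) = 1"
    by (simp add: lead_coeff_prod)
  ultimately show ?thesis by simp
qed

lemma card_field_ge_2: "CARD('a::{finite,field}) \<ge> 2"
proof -
  have "card {0, 1::'a} \<le> CARD('a)" by (rule card_mono) auto
  then show ?thesis by simp
qed

text \<open>Multiplication by \<open>b\<close> permutes the nonzero elements and hence fixes their
  product.\<close>

lemma power_card_minus_1:
  fixes b :: "'a::{finite,field}"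
  assumes "b \<noteq> 0"
  shows "b ^ (CARD('a) - 1) = 1"
proof -
  have "(\<Prod>x\<in>UNIV - {0}. b * x) = (\<Prod>x\<in>UNIV - {0::'a}. x)"
    by (rule prod.reindex_bij_witness[of _ "\<lambda>x. x / b" "\<lambda>x. b * x"]) (use assms in auto)
  then have "b ^ (CARD('a) - 1) * (\<Prod>x\<in>UNIV - {0::'a}. x) = (\<Prod>x\<in>UNIV - {0::'a}. x)"
    by (simp add: prod.distrib card_Diff_singleton)
  then show ?thesis by simp
qed

lemma power_card: "(b::'a::{finite,field}) ^ CARD('a) = b"
proof (cases "b = 0")
  case False
  have "b ^ CARD('a) = b * b ^ (CARD('a) - 1)"
    using card_field_ge_2[where 'a='a] by (simp flip: power_Suc)
  then show ?thesis using power_card_minus_1[OF False] by simp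
qed (use card_field_ge_2[where 'a='a] in auto)

lemma power_mult_card_minus_1: "(b::'a::{finite,field}) ^ (s * (CARD('a) - 1) + 1) = b"
proof (cases "b = 0")
  case False
  have "b ^ (s * (CARD('a) - 1)) = (b ^ (CARD('a) - 1)) ^ s" by (metis power_mult mult.commute)
  then show ?thesis by (simp only: power_add power_one_right power_card_minus_1[OF False] power_one mult_1_left)
qed simp

lemma power_card_power: "(b::'a::{finite,field}) ^ (CARD('a) ^ m) = b"
proof (induction m)
  case (Suc m)
  then show ?case by (simp only: power_Suc power_mult power_card)
qed simp

text \<open>If the remainder r of \<open>i\<close> modulo q-1 were nonzero, X^r - 1 would be a
  nonzero polynomial of degree below q-1 with q-1 roots.\<close>

lemma power_eq_one_imp_dvd:
  assumes "\<And>b::'a::{finite,field}. b \<noteq> 0 \<Longrightarrow> b ^ i = 1"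
  shows "(CARD('a) - 1) dvd i"
proof (rule ccontr)
  define n where "n = CARD('a) - 1"
  assume "\<not> ?thesis"
  then have r0: "i mod n \<noteq> 0" by (simp add: n_def dvd_eq_mod_eq_0)
  have n: "n > 0" using card_field_ge_2[where 'a='a] by (simp add: n_def)
  let ?p = "monom 1 (i mod n) - 1 :: 'a poly"
  have deg: "degree ?p < n"
    using n by (intro degree_diff_less) (auto simp: degree_monom_eq)
  have "b ^ (i mod n) = 1" if "b \<noteq> 0" for b :: 'a
  proof -
    have "b ^ i = (b ^ n) ^ (i div n) * b ^ (i mod n)" by (simp flip: power_mult power_add)
    then show ?thesis using power_card_minus_1[OF that] assms[OF that] by (simp add: n_def)
  qed
  then have "?p = 0"
    using deg by (intro poly_eq_0_by_roots[of "UNIV - {0}"])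
      (auto simp: poly_monom n_def card_Diff_singleton)
  then have "coeff ?p (i mod n) = 0" by simp
  then show False using r0 by (simp add: coeff_1)
qed

text \<open>For nonzero \<open>y\<close>, both sides are monic of degree q in \<open>t\<close> and
  vanish at the q distinct points \<open>\<iota> b * y\<close>.\<close>

lemma prod_shifted:
  fixes \<iota> :: "'a::{finite,field} \<Rightarrow> 's::idom"
  assumes "rhom \<iota>"
  shows "(\<Prod>b\<in>UNIV. t - \<iota> b * y) = t ^ CARD('a) - y ^ (CARD('a) - 1) * t"
proof (cases "y = 0")
  case True
  have "CARD('a) - 1 \<noteq> 0" using card_field_ge_2[where 'a='a] by linarith
  then show ?thesis using True by (simp add: power_0_left)
next
  case False
  let ?q = "CARD('a)"
  let ?S = "range (\<lambda>b. \<iota> b * y)"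
  have inj: "inj (\<lambda>b. \<iota> b * y)" using False by (auto simp: inj_def rhom_inj[OF assms])
  let ?A = "\<Prod>x\<in>?S. [:- x, 1:]" and ?B = "monom 1 ?q - monom (y ^ (?q - 1)) 1"
  have q2: "?q \<ge> 2" by (rule card_field_ge_2)
  have cS: "card ?S = ?q" by (simp add: card_image[OF inj])
  have A: "degree ?A = ?q" "coeff ?A ?q = 1"
    using monic_degree_prod_linear[of ?S] cS by metis+
  have B: "degree ?B \<le> ?q" "coeff ?B ?q = 1"
    using q2 by (auto intro!: degree_diff_le degree_monom_le[THEN order_trans])
  have "degree (?A - ?B) < ?q"
  proof -
    have "coeff (?A - ?B) ?q = 0" using A B by simp
    moreover have "degree (?A - ?B) \<le> ?q" using A B by (simp add: degree_diff_le)
    ultimately show ?thesis using q2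
      by (metis degree_0 le_neq_implies_less leading_coeff_0_iff not_numeral_le_zero neq0_conv)
  qed
  moreover have "poly (?A - ?B) x = 0" if "x \<in> ?S" for x
  proof -
    from that obtain b where b: "x = \<iota> b * y" by auto
    have "poly ?A x = 0" using that by (auto simp: poly_prod intro!: prod_zero)
    moreover have "x ^ ?q = y ^ (?q - 1) * x"
    proof -
      have "x ^ ?q = \<iota> (b ^ ?q) * y ^ ?q" by (simp add: b power_mult_distrib rhom_power[OF assms])
      also have "\<dots> = \<iota> b * (y ^ (?q - 1) * y)" using q2 by (simp add: power_card flip: power_Suc2)
      finally show ?thesis by (simp add: b)
    qed
    ultimately show ?thesis by (simp add: poly_monom)
  qed
  ultimately have "?A - ?B = 0" using cS by (intro poly_eq_0_by_roots[of ?S]) auto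
  then have "poly ?A t = poly ?B t" by simp
  then show ?thesis by (simp add: poly_prod poly_monom prod.reindex[OF inj])
qed

text \<open>The product formula at \<open>t = x + y\<close> and at \<open>t = x\<close> runs over
  the same factors, since b -> b+1 permutes the field; comparing the two right-hand sides gives
  additivity.\<close>

lemma frobenius_add:
  fixes \<iota> :: "'a::{finite,field} \<Rightarrow> 's::idom" and x y :: 's
  assumes "rhom \<iota>"
  shows "(x + y) ^ CARD('a) = x ^ CARD('a) + y ^ CARD('a)"
proof -
  have "(\<Prod>b\<in>UNIV. x + y - \<iota> b * y) = (\<Prod>b\<in>UNIV. x - \<iota> b * y)"
    by (rule prod.reindex_bij_witness[of _ "\<lambda>b. b + 1" "\<lambda>b. b - 1"])
       (auto simp: rhom_simps[OF assms] algebra_simps)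
  then have "(x + y) ^ CARD('a) = x ^ CARD('a) + y ^ (CARD('a) - 1) * y"
    unfolding prod_shifted[OF assms] by (simp add: algebra_simps)
  then show ?thesis using card_field_ge_2[where 'a='a] by (simp only: power_minus_mult)
qed

lemma frobenius_add_power:
  fixes \<iota> :: "'a::{finite,field} \<Rightarrow> 's::idom" and x y :: 's
  assumes "rhom \<iota>"
  shows "(x + y) ^ (CARD('a) ^ m) = x ^ (CARD('a) ^ m) + y ^ (CARD('a) ^ m)"
proof (induction m)
  case (Suc m)
  have "CARD('a) ^ Suc m = CARD('a) ^ m * CARD('a)" by simp
  then show ?case by (simp only: power_mult Suc frobenius_add[OF assms])
qed simp

lemma power_minus_1_mult_card: "(y :: 'b::monoid_mult) ^ (CARD('a::{finite,field}) - 1) * y = y ^ CARD('a)"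
  using card_field_ge_2[where 'a='a] by (intro power_minus_mult) simp

section \<open>Linear forms\<close>

definition lin :: "'a \<Rightarrow> 'a \<Rightarrow> 'a::{finite,field} poly poly" where
  "lin a b = C2 a * X1 + C2 b * X2"

lemma span2_eq: "span2 = range (\<lambda>(a, b). lin a b)"
  by (auto simp: span2_def lin_def)

lemma lin_in_span2: "lin a b \<in> span2"
  by (auto simp: span2_eq)

lemma span2_cases:
  assumes "v \<in> span2"
  obtains a b where "v = lin a b"
  using assms by (auto simp: span2_eq)

lemma lin_altdef: "lin a b = [:[:0, a:], [:b:]:]"
  by (simp add: lin_def C2_def X1_def X2_def)

lemma lin_inj: "lin a b = lin a' b' \<longleftrightarrow> a = a' \<and> b = b'"
  by (simp add: lin_altdef)

lemma finite_span2: "finite (span2 :: 'a::{finite,field} poly poly set)"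
  by (simp add: span2_eq)

lemma card_span2: "card (span2 :: 'a::{finite,field} poly poly set) = CARD('a) ^ 2"
proof -
  have "inj (\<lambda>(a, b). lin a b :: 'a poly poly)" by (auto simp: inj_def lin_inj)
  then show ?thesis by (simp add: span2_eq card_image power2_eq_square flip: UNIV_Times_UNIV)
qed

lemma lin_add: "lin a b + lin a' b' = lin (a + a') (b + b')"
  by (simp add: lin_altdef)

lemma lin_uminus: "- lin a b = lin (- a) (- b)"
  by (simp add: lin_altdef)

lemma C2_mult_lin: "C2 c * lin a b = lin (c * a) (c * b)"
  by (simp add: lin_altdef C2_def)

lemma X1_eq_lin: "X1 = lin 1 0" and X2_eq_lin: "X2 = lin 0 1"
  by (simp_all add: lin_altdef X1_def X2_def one_pCons)

lemma C2_X1_eq_lin: "C2 c * X1 = lin c 0" and C2_X2_eq_lin: "C2 c * X2 = lin 0 c"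
  by (simp_all add: X1_eq_lin X2_eq_lin C2_mult_lin)

lemma X1_nz: "X1 \<noteq> (0 :: 'a::{finite,field} poly poly)" and X2_nz: "X2 \<noteq> (0 :: 'a poly poly)"
  by (simp_all add: X1_def X2_def)

lemma C2_power_card_power: "C2 (a::'a::{finite,field}) ^ (CARD('a) ^ m) = C2 a"
  by (simp only: rhom_power[OF rhom_C2, symmetric] power_card_power)

lemma C2_power_card: "C2 (a::'a::{finite,field}) ^ CARD('a) = C2 a"
  using C2_power_card_power[of a 1] by simp

lemma lin_power:
  fixes a b :: "'a::{finite,field}"
  shows "lin a b ^ (CARD('a) ^ m) = C2 a * X1 ^ (CARD('a) ^ m) + C2 b * X2 ^ (CARD('a) ^ m)"
  by (simp only: lin_def frobenius_add_power[OF rhom_C2] power_mult_distrib C2_power_card_power)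

lemma lin_power_card:
  fixes a b :: "'a::{finite,field}"
  shows "lin a b ^ CARD('a) = C2 a * X1 ^ CARD('a) + C2 b * X2 ^ CARD('a)"
  using lin_power[of a b 1] by simp

lemma sub_lin: "sub (lin a b) u v = C2 a * u + C2 b * v"
  by (simp add: lin_def sub_simps)

lemma sub_L2:
  fixes u v :: "'a::{finite,field} poly poly"
  shows "sub L2 u v = u * v ^ CARD('a) - v * u ^ CARD('a)"
  by (simp add: L2_def det2_def sub_simps)

lemma L2_eq: "(L2 :: 'a::{finite,field} poly poly) = X1 * X2 ^ CARD('a) - X2 * X1 ^ CARD('a)"
  by (simp add: L2_def det2_def)

text \<open>The q-th power is F_q-linear, so both rows of the determinant are transformed by the
  same matrix.\<close>

lemma sub_L2_lin: "sub L2 (lin a b) (lin c d) = C2 (a * d - b * c) * L2"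
  by (simp only: sub_L2 lin_power_card, simp only: L2_eq rhom_simps[OF rhom_C2])
     (simp add: lin_def algebra_simps)

lemma sub_L2_same: "sub L2 u u = 0"
  by (simp add: sub_L2)

lemma sub_L2_scale: "sub L2 u (C2 b * u) = 0"
  by (simp add: sub_L2 power_mult_distrib C2_power_card algebra_simps)

text \<open>The product of all x2 - b x1, that is, \<open>L2\<close> without its factor x1. Unlike
  \<open>L2\<close> it is monic in the outer variable.\<close>

definition zf :: "'a::{finite,field} poly poly" where
  "zf = X2 ^ CARD('a) - X1 ^ (CARD('a) - 1) * X2"

lemma zf_eq_prod: "zf = (\<Prod>b\<in>(UNIV::'a::{finite,field} set). [:- [:0, b:], 1:])"
proof -
  have "(\<Prod>b\<in>UNIV. X2 - C2 b * X1) = (zf :: 'a poly poly)"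
    unfolding zf_def by (rule prod_shifted[OF rhom_C2])
  then show ?thesis by (simp add: X2_def C2_def X1_def)
qed

lemma L2_eq_zf: "L2 = X1 * zf"
  by (simp add: L2_eq zf_def algebra_simps power_minus_1_mult_card[symmetric])

lemma zf_degree: "degree (zf :: 'a::{finite,field} poly poly) = CARD('a)"
  and zf_monic: "lead_coeff (zf :: 'a poly poly) = 1"
proof -
  have inj: "inj (\<lambda>b. [:0, b::'a:])" by (simp add: inj_def)
  have "zf = (\<Prod>x\<in>range (\<lambda>b. [:0, b::'a:]). [:- x, 1:])"
    by (simp only: zf_eq_prod prod.reindex[OF inj] o_def)
  then show "degree (zf :: 'a poly poly) = CARD('a)" "lead_coeff (zf :: 'a poly poly) = 1"
    using monic_degree_prod_linear[of "range (\<lambda>b. [:0, b::'a:])"] card_image[OF inj] by auto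
qed

lemma zf_nz: "zf \<noteq> (0 :: 'a::{finite,field} poly poly)"
proof
  assume "zf = (0 :: 'a poly poly)"
  with zf_monic[where 'a='a] show False by simp
qed

lemma L2_nz: "L2 \<noteq> (0 :: 'a::{finite,field} poly poly)"
  by (simp add: L2_eq_zf zf_nz X1_nz)

lemma sub_X1_mult: "sub r X1 (C2 b * X1) = [:poly r [:0, b:]:]"
proof (rule rhom_eqI2[where \<theta> = "\<lambda>r. sub r X1 (C2 b * X1)" and \<theta>' = "\<lambda>r. [:poly r [:0, b:]:]"])
  show "rhom (\<lambda>r. [:poly r [:0, b:]:])" by (rule rhom_comp[OF rhom_poly rhom_const_poly])
qed (simp_all add: rhom_sub sub_simps, simp_all add: C2_def X1_def X2_def)

lemma sub_0_X2: "sub r 0 X2 = map_poly (\<lambda>c. [:poly c 0:]) r"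
proof (rule rhom_eqI2[where \<theta> = "\<lambda>r. sub r 0 X2"])
  show "rhom (map_poly (\<lambda>c. [:poly c 0:]))"
    by (rule rhom_map_poly[OF rhom_comp[OF rhom_poly rhom_const_poly]])
qed (simp_all add: rhom_sub sub_simps, simp_all add: C2_def X1_def X2_def map_poly_pCons one_pCons)

text \<open>\<open>X1\<close> is constant in the outer variable, so divisibility is tested
  coefficient by coefficient.\<close>

lemma X1_dvd_iff: "X1 dvd (r :: 'a::{finite,field} poly poly) \<longleftrightarrow> sub r 0 X2 = 0"
proof -
  have "X1 dvd r \<longleftrightarrow> (\<forall>n. poly (coeff r n) 0 = 0)"
    by (simp add: X1_def const_poly_dvd_iff poly_eq_0_iff_dvd)
  also have "\<dots> \<longleftrightarrow> sub r 0 X2 = 0"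
    by (simp add: sub_0_X2 poly_eq_iff[of _ 0] coeff_map_poly coeff_pCons split: nat.splits)
  finally show ?thesis .
qed

lemma zf_dvd:
  assumes "\<And>b. sub r X1 (C2 b * X1) = 0"
  shows "zf dvd (r :: 'a::{finite,field} poly poly)"
proof -
  have inj: "inj (\<lambda>b. [:0, b::'a:])" by (simp add: inj_def)
  have "poly r [:0, b:] = 0" for b using assms[of b] by (simp add: sub_X1_mult)
  then have "(\<Prod>x\<in>range (\<lambda>b. [:0, b::'a:]). [:- x, 1:]) dvd r"
    by (intro prod_linear_dvd) auto
  then show ?thesis by (simp only: zf_eq_prod prod.reindex[OF inj] o_def)
qed

text \<open>\<open>L2\<close> is the product of the linear forms cutting out the q+1 lines x1 = 0
  and x2 = b x1. After \<open>zf\<close> is split off, the cofactor still vanishes on x1 = 0 because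
  \<open>zf\<close> restricts there to the nonzero x2^q.\<close>

lemma L2_dvd:
  assumes "sub r 0 X2 = 0" "\<And>b. sub r X1 (C2 b * X1) = 0"
  shows "L2 dvd (r :: 'a::{finite,field} poly poly)"
proof -
  obtain k where k: "r = zf * k" using zf_dvd[OF assms(2)] by (auto simp: dvd_def)
  have "sub zf 0 X2 = (X2 ^ CARD('a) :: 'a poly poly)"
    using card_field_ge_2[where 'a='a] by (simp add: zf_def sub_simps power_0_left)
  then have "sub k 0 X2 = 0" using assms(1) X2_nz[where 'a='a] by (auto simp: k sub_simps)
  then show ?thesis unfolding L2_eq_zf k using X1_dvd_iff[of k] by (simp add: mult.commute mult_dvd_mono)
qed

section \<open>The Dickson polynomial\<close>

lemma ev3_X1_X2: "ev3 p X1 X2 w = poly p w"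
  by (simp add: ev3_def sub_X1_X2)

lemma degree_less_if_coeff_eq_0:
  assumes "degree p \<le> n" "coeff p n = 0" "n > 0"
  shows "degree p < n"
  using assms by (metis degree_0 le_neq_implies_less leading_coeff_0_iff)

lemma dickson_prod_eq: "dickson_prod = (\<Prod>v\<in>(span2 :: 'a::{finite,field} poly poly set). [:- v, 1:])"
  unfolding dickson_prod_def
  by (rule prod.reindex_bij_witness[of _ uminus uminus]) (auto elim!: span2_cases simp: lin_uminus lin_in_span2)

lemma dickson_prod_degree: "degree (dickson_prod :: 'a::{finite,field} poly poly poly) = CARD('a) ^ 2"
  and dickson_prod_monic: "lead_coeff (dickson_prod :: 'a poly poly poly) = 1"
  using monic_degree_prod_linear[of "span2 :: 'a poly poly set"] by (auto simp: dickson_prod_eq card_span2)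

lemma ev3_L3:
  fixes u v w :: "'a::{finite,field} poly poly"
  shows "ev3 L3 u v w = det3 u v w (u ^ CARD('a)) (v ^ CARD('a)) (w ^ CARD('a))
    (u ^ (CARD('a)^2)) (v ^ (CARD('a)^2)) (w ^ (CARD('a)^2))"
  by (simp add: L3_def det3_def ev3_simps)

text \<open>The columns depend F_q-linearly on \<open>u\<close>, \<open>v\<close>, \<open>w\<close>,
  and three elements of a plane are linearly dependent.\<close>

lemma ev3_L3_span2:
  assumes "u \<in> span2" "v \<in> span2" "w \<in> span2"
  shows "ev3 L3 u v w = 0"
proof -
  from assms obtain a b c d e g where "u = lin a b" "v = lin c d" "w = lin e g" by (metis span2_cases)
  then show ?thesis unfolding ev3_L3 det3_def
    by (simp only: lin_power lin_power_card) (simp add: lin_def algebra_simps)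
qed

text \<open>Expansion along the column of the third variable, whose entries have exponents 1, q and
  q^2.\<close>

lemma L3_expand: "(L3 :: 'a::{finite,field} poly poly poly) =
   monom (X1 ^ CARD('a) * X2 ^ (CARD('a)^2) - X2 ^ CARD('a) * X1 ^ (CARD('a)^2)) 1
   - monom (X1 * X2 ^ (CARD('a)^2) - X2 * X1 ^ (CARD('a)^2)) (CARD('a))
   + monom L2 (CARD('a)^2)"
proof -
  have Y3: "Y3 ^ n = monom (1::'a poly poly) n" for n by (simp add: Y3_def monom_altdef)
  have Y31: "Y3 = monom (1::'a poly poly) 1" using Y3[of 1] by simp
  have "(L3 :: 'a poly poly poly) = det3 [:X1:] [:X2:] (monom 1 1) ([:X1 ^ CARD('a):]) ([:X2 ^ CARD('a):]) (monom 1 (CARD('a)))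
      ([:X1 ^ (CARD('a)^2):]) ([:X2 ^ (CARD('a)^2):]) (monom 1 (CARD('a)^2))"
    by (simp only: L3_def Y1_eq Y2_eq Y3 poly_const_pow) (simp only: Y31)
  then show ?thesis
    by (simp add: det3_def L2_eq smult_monom flip: add_monom diff_monom) (simp add: smult_monom smult_diff_right algebra_simps flip: add_monom diff_monom)
qed

text \<open>Both sides have the same coefficient at q^2 and vanish at the q^2 elements of the span,
  so their difference has more roots than its degree allows.\<close>

lemma L3_eq: "(L3 :: 'a::{finite,field} poly poly poly) = [:L2:] * dickson_prod"
proof -
  let ?q = "CARD('a)"
  have q: "?q \<ge> 2" by (rule card_field_ge_2)
  then have q2: "?q < ?q ^ 2" "1 < ?q ^ 2" using less_1_mult[of ?q ?q] by (auto simp: power2_eq_square)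
  let ?D = "L3 - [:L2:] * dickson_prod :: 'a poly poly poly"
  have d1: "degree (L3 :: 'a poly poly poly) \<le> ?q ^ 2"
    unfolding L3_expand using q2
    by (intro degree_add_le degree_diff_le) (auto intro: order_trans[OF degree_monom_le])
  have d2: "degree ([:L2:] * dickson_prod :: 'a poly poly poly) \<le> ?q ^ 2"
    using degree_smult_le[of L2 dickson_prod] by (simp add: dickson_prod_degree)
  have c: "coeff (dickson_prod :: 'a poly poly poly) (?q ^ 2) = 1"
    using dickson_prod_monic dickson_prod_degree by metis
  have "coeff ?D (?q ^ 2) = 0"
    using q2 by (simp add: c L3_expand)
  moreover have "degree ?D \<le> ?q ^ 2" using d1 d2 by (rule degree_diff_le)
  ultimately have "degree ?D < ?q ^ 2" using q2 by (intro degree_less_if_coeff_eq_0) auto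
  moreover have "poly ?D v = 0" if "v \<in> span2" for v
  proof -
    have "poly L3 v = 0"
      using ev3_L3_span2[of X1 X2 v] that by (simp add: X1_eq_lin X2_eq_lin lin_in_span2 flip: ev3_X1_X2)
    moreover have "poly dickson_prod v = 0"
      using that finite_span2 by (auto simp: dickson_prod_eq poly_prod intro!: prod_zero)
    ultimately show ?thesis by simp
  qed
  ultimately have "?D = 0" by (intro poly_eq_0_by_roots[of span2]) (auto simp: finite_span2 card_span2)
  then show ?thesis by simp
qed

text \<open>Write D K = c N and divide N by D with quotient K' and remainder r. Then D (K - c K') =
  c r, and comparing degrees forces K = c K'.\<close>

lemma const_dvd_monic_mult:
  fixes D K :: "'r::idom poly"
  assumes "lead_coeff D = 1" "[:c:] dvd D * K"
  shows "[:c:] dvd K"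
proof -
  from assms(2) obtain N where N: "D * K = smult c N" by (auto simp: dvd_def)
  have D0: "D \<noteq> 0" using assms(1) by auto
  \<comment> \<open>As \<open>D\<close> is monic, the multiplier in pseudo-division is 1 and this is
    ordinary division with remainder.\<close>
  obtain K' r where pdm: "pseudo_divmod N D = (K', r)" by fastforce
  have NK: "N = D * K' + r" and r: "r = 0 \<or> degree r < degree D"
    using pseudo_divmod[OF D0 pdm] assms(1) by auto
  have eq: "D * (K - smult c K') = smult c r"
    using N by (simp add: NK algebra_simps smult_add_right)
  have "K - smult c K' = 0"
  proof (rule ccontr)
    assume nz: "K - smult c K' \<noteq> 0"
    then have "smult c r \<noteq> 0" using eq D0 by (metis mult_eq_0_iff)
    then have "r \<noteq> 0" "degree (smult c r) \<le> degree r" by (auto simp: degree_smult_le)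
    moreover have "degree (smult c r) \<ge> degree D"
      unfolding eq[symmetric] using degree_mult_eq[OF D0 nz] by simp
    ultimately show False using r by simp
  qed
  then have "K = [:c:] * K'" by simp
  then show ?thesis by (metis dvd_triv_left)
qed

section \<open>A Pluecker-type description of the module\<close>

text \<open>With F = f L2, this is the vanishing of the numerator of delta_{3;m}(f) on all triples
  from the span.\<close>

definition pluecker :: "nat \<Rightarrow> 'a::{finite,field} poly poly \<Rightarrow> bool" where
  "pluecker m F \<longleftrightarrow> (\<forall>u\<in>span2. \<forall>v\<in>span2. \<forall>w\<in>span2.
     v ^ (CARD('a) ^ m) * sub F u w = u ^ (CARD('a) ^ m) * sub F v w + w ^ (CARD('a) ^ m) * sub F u v)"

lemma plueckerD:
  fixes F :: "'a::{finite,field} poly poly"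
  assumes "pluecker m F" "u \<in> span2" "v \<in> span2" "w \<in> span2"
  shows "v ^ (CARD('a) ^ m) * sub F u w = u ^ (CARD('a) ^ m) * sub F v w + w ^ (CARD('a) ^ m) * sub F u v"
  using assms unfolding pluecker_def by blast

lemma X1_in_span2: "X1 \<in> span2" and X2_in_span2: "X2 \<in> span2" and C2_X1_in_span2: "C2 b * X1 \<in> span2"
  by (simp_all only: X1_eq_lin X2_eq_lin C2_mult_lin lin_in_span2)

lemma pluecker_0: "pluecker m 0"
  by (simp add: pluecker_def sub_simps)

lemma pluecker_add:
  assumes "pluecker m F" "pluecker m G"
  shows "pluecker m (F + G)"
  unfolding pluecker_def
proof (intro ballI)
  fix u v w :: "'a poly poly" assume *: "u \<in> span2" "v \<in> span2" "w \<in> span2"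
  show "v ^ (CARD('a) ^ m) * sub (F + G) u w = u ^ (CARD('a) ^ m) * sub (F + G) v w + w ^ (CARD('a) ^ m) * sub (F + G) u v"
    using plueckerD[OF assms(1) *] plueckerD[OF assms(2) *] by (simp add: sub_simps algebra_simps)
qed

lemma sub_mult_L2_same: "sub (f * L2) u u = 0" and sub_mult_L2_scale: "sub (f * L2) u (C2 b * u) = 0"
  by (simp_all add: sub_simps sub_L2_same sub_L2_scale)

context
  fixes m :: nat and F f :: "'a::{finite,field} poly poly"
  assumes pl: "pluecker m F" and F: "F = f * L2"
begin

text \<open>The relation at (X1, X2, X1), where F(X1, X1) = 0, gives the claim for the variables
  themselves; substitution extends it to arbitrary \<open>u\<close> and \<open>v\<close>.\<close>

lemma pluecker_skew: "sub F v u = - sub F u v"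
proof -
  have z0: "sub F X1 X1 = 0" by (simp add: F sub_mult_L2_same)
  have "X1 ^ (CARD('a) ^ m) * (sub F X2 X1 + sub F X1 X2) = 0"
    using plueckerD[OF pl X1_in_span2 X2_in_span2 X1_in_span2]
    by (simp add: z0 algebra_simps)
  then have "sub F X2 X1 = - sub F X1 X2" using X1_nz[where 'a='a] by (simp add: eq_neg_iff_add_eq_0)
  then have "sub (sub F X2 X1) u v = sub (- sub F X1 X2) u v" by simp
  then show ?thesis by (simp only: sub_sub sub_simps)
qed

text \<open>The relation at (X1, X2, b X1): its left side vanishes because \<open>L2\<close> does on
  proportional arguments, and b^Q = b.\<close>

lemma pluecker_scale: "sub F (C2 b * u) v = C2 b * sub F u v"
proof -
  have z0: "sub F X1 (C2 b * X1) = 0" by (simp add: F sub_mult_L2_scale)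
  have "X1 ^ (CARD('a) ^ m) * (sub F X2 (C2 b * X1) + C2 b * sub F X1 X2) = 0"
    using plueckerD[OF pl X1_in_span2 X2_in_span2 C2_X1_in_span2[of b]]
    unfolding z0 power_mult_distrib C2_power_card_power by (simp add: algebra_simps)
  then have "sub F X2 (C2 b * X1) = - (C2 b * sub F X1 X2)" using X1_nz[where 'a='a] by (simp add: eq_neg_iff_add_eq_0)
  then have "sub (sub F X2 (C2 b * X1)) u v = sub (- (C2 b * sub F X1 X2)) u v" by simp
  then have "sub F v (C2 b * u) = - (C2 b * sub F u v)" by (simp only: sub_sub sub_simps)
  then show ?thesis using pluecker_skew[of "C2 b * u" v] by simp
qed

end

text \<open>Expansion along the last row: each 2 x 2 minor of the first two rows is
  \<open>L2\<close> in the two remaining variables, and it is absorbed into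
  \<open>f * L2\<close>.\<close>

lemma delta3_num_eq:
  fixes f :: "'a::{finite,field} poly poly"
  shows "delta3_num m f = Y1 ^ (CARD('a)^m) * ev2 C3 (f * L2) Y2 Y3
    - Y2 ^ (CARD('a)^m) * ev2 C3 (f * L2) Y1 Y3 + Y3 ^ (CARD('a)^m) * ev2 C3 (f * L2) Y1 Y2"
  by (simp add: delta3_num_def det3_def L2_eq ev2_simps[OF rhom_C3] algebra_simps)

lemma ev2_C3_Y1_Y2: "ev2 C3 f Y1 Y2 = [:f:]"
  by (rule rhom_eqI2[OF rhom_ev2[OF rhom_C3] rhom_const_poly, symmetric, THEN sym])
     (simp_all add: ev2_simps[OF rhom_C3] C3_eq Y1_eq Y2_eq)

lemma const_L2_dvd:
  fixes T :: "'a::{finite,field} poly poly poly"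
  assumes "map_poly (\<lambda>r. sub r 0 X2) T = 0" "\<And>b. map_poly (\<lambda>r. sub r X1 (C2 b * X1)) T = 0"
  shows "[:L2:] dvd T"
  unfolding const_poly_dvd_iff
proof
  fix n
  have *: "sub (coeff T n) u v = coeff (map_poly (\<lambda>r. sub r u v) T) n" for u v :: "'a poly poly"
    by (simp add: coeff_map_poly sub_simps)
  show "L2 dvd coeff T n"
    by (rule L2_dvd) (simp_all add: * assms)
qed

lemma map_poly_sub_ev2:
  "map_poly (\<lambda>r. sub r u v) (ev2 C3 F y y') = ev2 C3 F (map_poly (\<lambda>r. sub r u v) y) (map_poly (\<lambda>r. sub r u v) y')"
proof -
  have "map_poly (\<lambda>r. sub r u v) (C3 c) = C3 c" for c
    by (simp add: C3_eq map_poly_pCons sub_simps)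
  then show ?thesis using rhom_ev2_apply[OF rhom_map_poly[OF rhom_sub[of u v]] rhom_C3, of F y y'] by simp
qed

lemma map_poly_sub_Y: "map_poly (\<lambda>r. sub r u v) Y1 = [:u:]" "map_poly (\<lambda>r. sub r u v) Y2 = [:v:]"
   "map_poly (\<lambda>r. sub r u v) Y3 = Y3"
  by (simp_all add: Y1_eq Y2_eq map_poly_pCons sub_simps) (simp add: Y3_def map_poly_pCons sub_simps)

text \<open>Substituting a triple of the span into L3 gives 0, hence one direction. Conversely, the
  relation at (X1, X2, v) makes the numerator divisible by the Dickson product; the other factor
  \<open>L2\<close> of L3 is treated separately and then cancelled past the monic Dickson
  product.\<close>

lemma A2_iff:
  fixes f :: "'a::{finite,field} poly poly"
  shows "f \<in> A2 m \<longleftrightarrow> pluecker m (f * L2)"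
proof
  assume "f \<in> A2 m"
  then have *: "L3 dvd delta3_num m f" by (simp add: A2_def)
  show "pluecker m (f * L2)" unfolding pluecker_def
  proof (intro ballI)
    fix u v w :: "'a poly poly" assume uvw: "u \<in> span2" "v \<in> span2" "w \<in> span2"
    have "ev3 L3 u v w dvd ev3 (delta3_num m f) u v w" by (rule rhom_dvd[OF rhom_ev3 *])
    then have "ev3 (delta3_num m f) u v w = 0" by (simp add: ev3_L3_span2[OF uvw])
    then show "v ^ (CARD('a) ^ m) * sub (f * L2) u w
      = u ^ (CARD('a) ^ m) * sub (f * L2) v w + w ^ (CARD('a) ^ m) * sub (f * L2) u v"
      unfolding delta3_num_eq by (simp only: ev3_simps) (simp add: algebra_simps)
  qed
next
  assume pl: "pluecker m (f * L2)"
  define N where "N = delta3_num m f"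
  define F where "F = f * L2"
  have Neq: "N = Y1 ^ (CARD('a)^m) * ev2 C3 F Y2 Y3 - Y2 ^ (CARD('a)^m) * ev2 C3 F Y1 Y3
      + Y3 ^ (CARD('a)^m) * ev2 C3 F Y1 Y2"
    by (simp add: N_def F_def delta3_num_eq)
  have "poly N v = 0" if "v \<in> span2" for v
    unfolding ev3_X1_X2[symmetric] Neq ev3_simps
    using plueckerD[OF pl X1_in_span2 X2_in_span2 that] by (simp add: F_def algebra_simps)
  then have "(dickson_prod :: 'a poly poly poly) dvd N"
    unfolding dickson_prod_eq by (rule prod_linear_dvd[OF finite_span2])
  then obtain K where K: "N = dickson_prod * K" by (auto simp: dvd_def)
  \<comment> \<open>\<open>T\<close> is the numerator modulo \<open>L2\<close>, since the omitted
    term contains F(x1, x2) = f L2. It remains to restrict \<open>T\<close> to the q+1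
    lines.\<close>
  define T where "T = Y1 ^ (CARD('a)^m) * ev2 C3 F Y2 Y3 - Y2 ^ (CARD('a)^m) * ev2 C3 F Y1 Y3"
  note hom = rhom_simps[OF rhom_map_poly[OF rhom_sub]]
  have q0: "CARD('a) ^ m \<noteq> 0" by simp
  have scale: "ev2 C3 F (C3 b * Y1) Y3 = C3 b * ev2 C3 F Y1 Y3" for b
  proof -
    have "ev2 C3 (sub F (C2 b * X1) X2) Y1 Y3 = ev2 C3 (C2 b * sub F X1 X2) Y1 Y3"
      using pluecker_scale[OF pl[folded F_def] F_def] by simp
    then show ?thesis
      unfolding rhom_ev2_apply[OF rhom_ev2[OF rhom_C3] rhom_C2] ev2_simps[OF rhom_C3] by simp
  qed
  have "[:L2:] dvd T"
  proof (rule const_L2_dvd)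
    have "ev2 C3 (L2 :: 'a poly poly) 0 Y3 = 0" using card_field_ge_2[where 'a='a]
      by (simp add: L2_eq ev2_simps[OF rhom_C3] power_0_left)
    then have "ev2 C3 F 0 Y3 = 0"
      unfolding F_def by (simp add: ev2_simps[OF rhom_C3])
    then show "map_poly (\<lambda>r. sub r 0 X2) T = 0"
      using q0 by (simp add: T_def hom map_poly_sub_ev2 map_poly_sub_Y power_0_left)
  next
    fix b :: 'a
    have *: "[:C2 b * X1:] = C3 b * Y1" by (simp add: C3_eq Y1_eq)
    have C3q: "C3 b ^ (CARD('a) ^ m) = C3 b" by (simp only: rhom_power[OF rhom_C3, symmetric] power_card_power)
    show "map_poly (\<lambda>r. sub r X1 (C2 b * X1)) T = 0"
      unfolding T_def hom map_poly_sub_ev2 map_poly_sub_Y * scale power_mult_distrib C3q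
      by (simp add: Y1_eq)
  qed
  moreover have "N = T + [:L2:] * ([:f:] * Y3 ^ (CARD('a)^m))"
    by (simp add: Neq T_def ev2_C3_Y1_Y2 F_def mult.commute)
  ultimately have "[:L2:] dvd dickson_prod * K" unfolding K[symmetric] by (metis dvd_add dvd_triv_left)
  then have "[:L2:] dvd K" by (rule const_dvd_monic_mult[OF dickson_prod_monic])
  then have "[:L2:] * dickson_prod dvd N" unfolding K by (metis mult.commute mult_dvd_mono dvd_refl)
  then show "f \<in> A2 m" by (simp add: A2_def L3_eq N_def)
qed

section \<open>Dickson's theorem in two variables\<close>

text \<open>The invariants of GL_2(F_q), an invertible matrix being given by the linear forms that
  replace x1 and x2.\<close>

definition Inv :: "'a::{finite,field} poly poly set" where
  "Inv = {f. \<forall>a b c d. a * d - b * c \<noteq> 0 \<longrightarrow> sub f (lin a b) (lin c d) = f}"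

lemma InvD: "f \<in> Inv \<Longrightarrow> a * d - b * c \<noteq> 0 \<Longrightarrow> sub f (lin a b) (lin c d) = f"
  by (simp add: Inv_def)

lemma InvI: "(\<And>a b c d. a * d - b * c \<noteq> 0 \<Longrightarrow> sub f (lin a b) (lin c d) = f) \<Longrightarrow> f \<in> Inv"
  by (simp add: Inv_def)

lemma Inv_diff: "f \<in> Inv \<Longrightarrow> g \<in> Inv \<Longrightarrow> f - g \<in> Inv"
  and Inv_mult: "f \<in> Inv \<Longrightarrow> g \<in> Inv \<Longrightarrow> f * g \<in> Inv"
  by (simp_all add: Inv_def sub_simps)

lemma Inv_cancel:
  assumes "g * k \<in> Inv" "g \<in> Inv" "g \<noteq> 0"
  shows "k \<in> Inv"
proof (rule InvI)
  fix a b c d :: 'a assume *: "a * d - b * c \<noteq> 0"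
  have "g * sub k (lin a b) (lin c d) = g * k"
    using InvD[OF assms(1) *] InvD[OF assms(2) *] by (simp add: sub_simps)
  then show "sub k (lin a b) (lin c d) = k" using assms(3) by simp
qed

lemma sub_lin_lin: "sub (lin e g) (lin a b) (lin c d) = lin (e * a + g * c) (e * b + g * d)"
  by (simp add: sub_lin C2_mult_lin lin_add)

lemma bij_betw_span2:
  fixes a b c d :: "'a::{finite,field}"
  assumes "a * d - b * c \<noteq> 0"
  shows "bij_betw (\<lambda>v. sub v (lin a b) (lin c d)) span2 span2"
proof -
  have inj: "inj_on (\<lambda>v. sub v (lin a b) (lin c d)) span2"
  proof (rule inj_onI)
    fix v w assume vw: "v \<in> span2" "w \<in> span2" "sub v (lin a b) (lin c d) = sub w (lin a b) (lin c d)"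
    from vw(1,2) obtain e g e' g' where eq: "v = lin e g" "w = lin e' g'" by (metis span2_cases)
    have 1: "e * a + g * c = e' * a + g' * c" and 2: "e * b + g * d = e' * b + g' * d"
      using vw(3) by (simp_all add: eq sub_lin_lin lin_inj)
    \<comment> \<open>Cramer's rule recovers the coefficients from their images.\<close>
    have "(a * d - b * c) * (e - e') = d * ((e * a + g * c) - (e' * a + g' * c)) - c * ((e * b + g * d) - (e' * b + g' * d))"
      by (simp add: algebra_simps)
    moreover have "(a * d - b * c) * (g - g') = a * ((e * b + g * d) - (e' * b + g' * d)) - b * ((e * a + g * c) - (e' * a + g' * c))"
      by (simp add: algebra_simps)
    ultimately show "v = w" unfolding 1 2 using assms by (simp add: eq)
  qed
  moreover have "(\<lambda>v. sub v (lin a b) (lin c d)) ` span2 \<subseteq> span2"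
    by (auto elim!: span2_cases simp: sub_lin_lin lin_in_span2)
  ultimately show ?thesis
    by (simp add: bij_betw_def endo_inj_surj[OF finite_span2])
qed

text \<open>An invertible substitution permutes the span and hence the linear factors of the
  product.\<close>

lemma coeff_dickson_prod_in_Inv: "coeff dickson_prod n \<in> (Inv :: 'a::{finite,field} poly poly set)"
proof (rule InvI)
  fix a b c d :: 'a assume *: "a * d - b * c \<noteq> 0"
  let ?\<sigma> = "\<lambda>r. sub r (lin a b) (lin c d)"
  have "map_poly ?\<sigma> dickson_prod = (\<Prod>v\<in>span2. [:- ?\<sigma> v, 1:])"
    by (simp add: dickson_prod_eq rhom_prod[OF rhom_map_poly[OF rhom_sub]] map_poly_pCons sub_simps)
  also have "\<dots> = dickson_prod"
    unfolding dickson_prod_eq by (rule prod.reindex_bij_betw[OF bij_betw_span2[OF *]])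
  finally show "?\<sigma> (coeff dickson_prod n) = coeff dickson_prod n"
    by (metis (no_types, lifting) coeff_map_poly rhom_0[OF rhom_sub])
qed

lemma dickson2_in_Inv: "dickson2 i \<in> Inv"
proof -
  have "(-1) ^ (2 - i) \<in> (Inv :: 'a poly poly set)" by (simp add: Inv_def sub_simps)
  then show ?thesis unfolding dickson2_def by (intro Inv_mult coeff_dickson_prod_in_Inv)
qed

lemma coeff_L3: "L2 * coeff dickson_prod n = coeff (L3 :: 'a::{finite,field} poly poly poly) n"
  by (simp add: L3_eq)

text \<open>In L3 = L2 * \<open>dickson_prod\<close>, the coefficient of the first power of the
  third variable is the Frobenius image of \<open>L2\<close>, namely \<open>L2\<close>^q.\<close>

lemma dickson2_0: "dickson2 0 = (L2 :: 'a::{finite,field} poly poly) ^ (CARD('a) - 1)"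
proof -
  let ?q = "CARD('a)"
  have q: "?q \<ge> 2" by (rule card_field_ge_2)
  have "(L2 :: 'a poly poly) ^ ?q = X1 ^ ?q * X2 ^ (?q ^ 2) - X2 ^ ?q * X1 ^ (?q ^ 2)"
  proof -
    have "?q ^ 2 = ?q * ?q" by (simp add: power2_eq_square)
    moreover have "(x + y) ^ ?q = x ^ ?q + y ^ ?q" for x y :: "'a poly poly"
      by (rule frobenius_add[OF rhom_C2])
    from this[of "x - y" y for x y] have "(x - y) ^ ?q = x ^ ?q - y ^ ?q" for x y :: "'a poly poly"
      by (simp add: algebra_simps)
    ultimately show ?thesis unfolding L2_eq by (simp only: power_mult_distrib power_mult)
  qed
  also have "\<dots> = coeff L3 1" using q by (simp add: L3_expand)
  also have "\<dots> = L2 * dickson2 0" by (simp add: coeff_L3[symmetric] dickson2_def)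
  finally have "L2 * dickson2 0 = L2 * (L2 :: 'a poly poly) ^ (?q - 1)"
    using q by (simp flip: power_Suc)
  then show ?thesis using L2_nz[where 'a='a] by simp
qed

lemma L2_mult_dickson2_1:
  "L2 * dickson2 1 = X1 * X2 ^ (CARD('a) ^ 2) - (X2 :: 'a::{finite,field} poly poly) * X1 ^ (CARD('a) ^ 2)"
proof -
  let ?q = "CARD('a)"
  have q: "?q \<ge> 2" by (rule card_field_ge_2)
  then have "?q \<noteq> ?q ^ 2" "?q \<noteq> 1" by (auto simp: power2_eq_square)
  then have "coeff (L3 :: 'a poly poly poly) ?q = - (X1 * X2 ^ (?q ^ 2) - X2 * X1 ^ (?q ^ 2))"
    by (simp add: L3_expand)
  then show ?thesis by (simp add: dickson2_def coeff_L3[symmetric] algebra_simps eq_neg_iff_add_eq_0)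
qed

lemma zf_mult_dickson2_1:
  "zf * dickson2 1 = X2 ^ (CARD('a) ^ 2) - X1 ^ (CARD('a) ^ 2 - 1) * (X2 :: 'a::{finite,field} poly poly)"
proof -
  have *: "X1 * (X1 :: 'a poly poly) ^ (CARD('a) ^ 2 - 1) = X1 ^ (CARD('a) ^ 2)"
    by (simp flip: power_Suc)
  have "X1 * (zf * dickson2 1) = L2 * (dickson2 1 :: 'a poly poly)" by (simp add: L2_eq_zf)
  also have "\<dots> = X1 * X2 ^ (CARD('a) ^ 2) - X2 * X1 ^ (CARD('a) ^ 2)" by (rule L2_mult_dickson2_1)
  also have "\<dots> = X1 * (X2 ^ (CARD('a) ^ 2) - X1 ^ (CARD('a) ^ 2 - 1) * (X2 :: 'a poly poly))"
    unfolding *[symmetric] by (simp only: algebra_simps)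
  finally have "X1 * (zf * dickson2 1) = X1 * (X2 ^ (CARD('a) ^ 2) - X1 ^ (CARD('a) ^ 2 - 1) * (X2 :: 'a poly poly))" .
  then show ?thesis using X1_nz[where 'a='a] by simp
qed

text \<open>On x1 = 0, \<open>zf\<close> becomes x2^q and its product with \<open>dickson2 1\<close>
  becomes x2^(q^2).\<close>

lemma sub_dickson2_1: "sub (dickson2 1) 0 X2 = (X2 :: 'a::{finite,field} poly poly) ^ (CARD('a) * (CARD('a) - 1))"
proof -
  let ?q = "CARD('a)"
  have q: "?q \<ge> 2" by (rule card_field_ge_2)
  then have *: "?q - 1 \<noteq> 0" "?q ^ 2 - 1 \<noteq> 0" "?q ^ 2 = ?q + ?q * (?q - 1)"
    using less_1_mult[of ?q ?q] by (auto simp: power2_eq_square algebra_simps)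
  have "sub zf 0 X2 * sub (dickson2 1) 0 X2 = sub (X2 ^ (?q ^ 2) - X1 ^ (?q ^ 2 - 1) * (X2 :: 'a poly poly)) 0 X2"
    unfolding zf_mult_dickson2_1[symmetric] by (simp add: sub_simps)
  then have "X2 ^ ?q * sub (dickson2 1) 0 X2 = (X2 :: 'a poly poly) ^ (?q ^ 2)"
    using * by (simp add: zf_def sub_simps power_0_left)
  also have "\<dots> = X2 ^ ?q * X2 ^ (?q * (?q - 1))" by (subst *(3)) (rule power_add)
  finally show ?thesis using X2_nz[where 'a='a] by simp
qed

lemma degree_dickson2_1: "degree (dickson2 1 :: 'a::{finite,field} poly poly) = CARD('a) * (CARD('a) - 1)"
proof -
  let ?q = "CARD('a)"
  have q: "?q \<ge> 2" by (rule card_field_ge_2)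
  then have q2: "1 < ?q ^ 2" "?q ^ 2 = ?q + ?q * (?q - 1)"
    using less_1_mult[of ?q ?q] by (auto simp: power2_eq_square algebra_simps)
  have eq: "zf * dickson2 1 = monom (1 :: 'a poly) (?q ^ 2) + monom (- ([:0, 1:] ^ (?q ^ 2 - 1))) 1"
    unfolding zf_mult_dickson2_1 by (simp add: X1_def X2_def monom_altdef poly_const_pow)
  have "degree (monom (- ([:0, (1 :: 'a):] ^ (?q ^ 2 - 1))) 1) < degree (monom (1 :: 'a poly) (?q ^ 2))"
    by (rule le_less_trans[OF degree_monom_le]) (use q2 in \<open>simp add: degree_monom_eq\<close>)
  then have d: "degree (zf * dickson2 1 :: 'a poly poly) = ?q ^ 2"
    unfolding eq by (simp add: degree_add_eq_left degree_monom_eq)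
  then have "dickson2 1 \<noteq> (0 :: 'a poly poly)" using q2 by auto
  then have "degree (zf * dickson2 1 :: 'a poly poly) = ?q + degree (dickson2 1 :: 'a poly poly)"
    by (simp add: degree_mult_eq zf_nz zf_degree)
  then show ?thesis using d q2 by simp
qed

section \<open>The Dickson algebra and its identification with the invariants\<close>

lemma rhom_D2_eval: "rhom (\<lambda>h. sub h (dickson2 0) (dickson2 1))"
  by (rule rhom_sub)

lemma D2I: "sub h (dickson2 0) (dickson2 1) \<in> D2"
  by (auto simp: D2_def)

lemma
  shows D2_0: "0 \<in> D2" and D2_1: "1 \<in> D2" and D2_C2: "C2 c \<in> D2"
    and D2_dickson2_0: "dickson2 0 \<in> D2" and D2_dickson2_1: "dickson2 1 \<in> D2"
  using D2I[of 0] D2I[of 1] D2I[of "C2 c"] D2I[of X1] D2I[of X2] by (simp_all add: sub_simps)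

lemma D2_add: "f \<in> D2 \<Longrightarrow> g \<in> D2 \<Longrightarrow> f + g \<in> D2"
  and D2_mult: "f \<in> D2 \<Longrightarrow> g \<in> D2 \<Longrightarrow> f * g \<in> D2"
  and D2_diff: "f \<in> D2 \<Longrightarrow> g \<in> D2 \<Longrightarrow> f - g \<in> D2"
  unfolding D2_def
  using rhom_add[OF rhom_D2_eval, symmetric] rhom_mult[OF rhom_D2_eval, symmetric] rhom_diff[OF rhom_D2_eval, symmetric]
  by blast+

lemma D2_sum: "(\<And>i. i \<in> I \<Longrightarrow> h i \<in> D2) \<Longrightarrow> (\<Sum>i\<in>I. h i) \<in> D2"
  by (induction I rule: infinite_finite_induct) (auto simp: D2_0 D2_add)

lemma D2_power: "f \<in> D2 \<Longrightarrow> f ^ n \<in> D2"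
  by (induction n) (auto simp: D2_1 D2_mult)

lemma D2_subset_Inv: "D2 \<subseteq> Inv"
proof
  fix f :: "'a poly poly" assume "f \<in> D2"
  then obtain h where h: "f = sub h (dickson2 0) (dickson2 1)" by (auto simp: D2_def)
  show "f \<in> Inv"
  proof (rule InvI)
    fix a b c d :: 'a assume "a * d - b * c \<noteq> 0"
    then show "sub f (lin a b) (lin c d) = f"
      by (simp add: h sub_sub InvD[OF dickson2_in_Inv])
  qed
qed

text \<open>Factors \<open>L2\<close> are split off one at a time. After j < q-1 of them the
  cofactor is semi-invariant for the character det^(-j); it vanishes on x1 = 0, hence on all q+1
  lines, and so contains another \<open>L2\<close>.\<close>

lemma Inv_dvd:
  fixes f :: "'a::{finite,field} poly poly"
  assumes f: "f \<in> Inv" and f0: "sub f 0 X2 = 0"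
  shows "L2 ^ (CARD('a) - 1) dvd f"
proof -
  have "L2 ^ j dvd f" if "j \<le> CARD('a) - 1" for j
    using that
  proof (induction j)
    case (Suc j)
    then obtain g where g: "f = L2 ^ j * g" by (auto simp: dvd_def)
    have semi: "C2 ((a * d - b * c) ^ j) * sub g (lin a b) (lin c d) = g" if "a * d - b * c \<noteq> 0" for a b c d
    proof -
      have "L2 ^ j * (C2 ((a * d - b * c) ^ j) * sub g (lin a b) (lin c d)) = sub f (lin a b) (lin c d)"
        by (simp only: g sub_simps sub_L2_lin power_mult_distrib rhom_power[OF rhom_C2]) (simp add: algebra_simps)
      also have "\<dots> = L2 ^ j * g" using InvD[OF f that] g by simp
      finally show ?thesis using L2_nz[where 'a='a] by simp
    qed
    have g0: "sub g 0 X2 = 0"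
    proof (cases "j = 0")
      case True
      then show ?thesis using f0 g by simp
    next
      case False
      have "\<not> (CARD('a) - 1) dvd j" using Suc.prems False by (auto dest: dvd_imp_le)
      \<comment> \<open>The matrix diag(b, 1) preserves the line x1 = 0 and multiplies the
        restriction of \<open>g\<close> by a scalar different from 1.\<close>
      then obtain b :: 'a where b: "b \<noteq> 0" "b ^ j \<noteq> 1" using power_eq_one_imp_dvd by metis
      have "sub (C2 (b ^ j) * sub g (lin b 0) (lin 0 1)) 0 X2 = sub g 0 X2"
        using semi[of b 1 0 0] b by simp
      then have "C2 (b ^ j) * sub g 0 X2 = sub g 0 X2"
        by (simp add: sub_simps sub_sub sub_lin rhom_0[OF rhom_C2] rhom_1[OF rhom_C2])
      then have "C2 (b ^ j - 1) * sub g 0 X2 = 0"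
        by (simp add: rhom_diff[OF rhom_C2] rhom_1[OF rhom_C2] algebra_simps)
      then show ?thesis using b rhom_eq_0_iff[OF rhom_C2, of "b ^ j - 1"] by simp
    qed
    have "L2 dvd g"
    proof (rule L2_dvd[OF g0])
      fix b :: 'a
      \<comment> \<open>This matrix, of determinant -1, carries the line x2 = b x1 to the line x1 =
        0.\<close>
      have "sub (C2 ((- b * 0 - 1 * 1) ^ j) * sub g (lin (- b) 1) (lin 1 0)) X1 (C2 b * X1) = sub g X1 (C2 b * X1)"
        using semi[of "- b" 0 1 1] by simp
      moreover have "sub g 0 X1 = 0"
        using sub_sub[of g 0 X2 0 X1] g0 by (simp add: sub_simps)
      ultimately show "sub g X1 (C2 b * X1) = 0"
        by (simp add: sub_simps sub_sub sub_lin rhom_simps[OF rhom_C2])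
    qed
    then show ?case unfolding g by (simp add: mult.commute mult_dvd_mono)
  qed simp
  then show ?thesis by simp
qed

lemma coeff_sub_0_X2: "coeff (sub r 0 X2) n = [:poly (coeff r n) 0:]"
  by (simp add: sub_0_X2 coeff_map_poly)

lemma sub_0_X2_eq_sum: "sub r 0 X2 = (\<Sum>n\<le>degree r. C2 (poly (coeff r n) 0) * X2 ^ n)"
proof -
  have "C2 c * X2 ^ n = monom [:c:] n" for c :: 'a and n
    by (simp add: C2_def X2_def monom_altdef)
  then show ?thesis
    by (intro poly_eqI) (auto simp: coeff_sub_0_X2 coeff_sum coeff_eq_0 sum.delta if_distrib cong: if_cong)
qed

lemma sub_X1_0: "sub f X1 0 = [:poly f 0:]"
  using sub_X1_mult[of f 0] by (simp add: rhom_0[OF rhom_C2])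

text \<open>Says that f(0, x2) is a polynomial in x2^q. By invariance f - f(x1, 0) vanishes at every
  x2 = b x1, so it equals \<open>zf\<close> times a polynomial that is again invariant and of
  smaller degree in x2.\<close>

lemma translation_invariant_coeff:
  fixes f :: "'a::{finite,field} poly poly"
  assumes "\<And>b. sub f X1 (X2 + C2 b * X1) = f" "poly (coeff f n) 0 \<noteq> 0"
  shows "CARD('a) dvd n"
  using assms
proof (induction "degree f" arbitrary: f n rule: less_induct)
  case less
  let ?q = "CARD('a)"
  have q: "?q \<ge> 2" by (rule card_field_ge_2)
  define c where "c = sub f X1 0"
  have c_inv: "sub c u v = c" if "u = X1" for u v
    using that by (simp add: c_def sub_sub sub_simps)
  have "zf dvd f - c"
  proof (rule zf_dvd)
    fix b
    have "sub (sub f X1 (X2 + C2 b * X1)) X1 0 = sub f X1 0" using less.prems(1)[of b] by simp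
    then show "sub (f - c) X1 (C2 b * X1) = 0"
      by (simp add: sub_simps c_inv) (simp add: sub_sub sub_simps c_def)
  qed
  then obtain k where k: "f = c + zf * k" by (auto simp: dvd_def algebra_simps)
  have zf_inv: "sub zf X1 (X2 + C2 b * X1) = zf" for b :: 'a
  proof -
    have "(X1 ^ (?q - 1) * X1 :: 'a poly poly) = X1 ^ ?q" by (rule power_minus_1_mult_card)
    then show ?thesis
      by (simp add: zf_def sub_simps frobenius_add[OF rhom_C2] power_mult_distrib C2_power_card algebra_simps)
  qed
  have k_inv: "sub k X1 (X2 + C2 b * X1) = k" for b
  proof -
    have "sub (c + zf * k) X1 (X2 + C2 b * X1) = c + zf * k" using less.prems(1)[of b] k by simp
    then have "zf * sub k X1 (X2 + C2 b * X1) = zf * k" by (simp add: sub_simps c_inv zf_inv)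
    then show ?thesis using zf_nz[where 'a='a] by simp
  qed
  have c0: "sub c 0 X2 = [:[:poly (coeff f 0) 0:]:]"
    by (simp add: c_def sub_X1_0 sub_0_X2 map_poly_pCons poly_0_coeff_0)
  have "sub zf 0 X2 = monom (1 :: 'a poly) ?q"
    using q by (simp add: zf_def sub_simps power_0_left) (simp add: X2_def monom_altdef)
  \<comment> \<open>At x1 = 0 the factor \<open>zf\<close> is x2^q, so the exponents of the cofactor
    are shifted by q.\<close>
  then have "sub f 0 X2 = sub c 0 X2 + monom 1 ?q * sub k 0 X2"
    by (subst k) (simp add: sub_simps)
  then have coeff_f: "coeff (sub f 0 X2) n = (if n = 0 then [:poly (coeff f 0) 0:] else 0) + (if ?q \<le> n then coeff (sub k 0 X2) (n - ?q) else 0)"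
    by (simp add: c0 coeff_monom_mult coeff_pCons split: nat.splits)
  show ?case
  proof (cases "n = 0")
    case False
    then have n: "?q \<le> n" "poly (coeff k (n - ?q)) 0 \<noteq> 0"
      using coeff_f less.prems(2) by (auto simp: coeff_sub_0_X2 split: if_splits)
    then have "k \<noteq> 0" by auto
    then have "degree (f - c) = ?q + degree k" by (simp add: k degree_mult_eq zf_nz zf_degree)
    moreover have "degree (f - c) \<le> degree f" by (intro degree_diff_le) (simp_all add: c_def sub_X1_0)
    ultimately have "degree k < degree f" using q by simp
    then have "?q dvd n - ?q" using n(2) k_inv by (intro less.hyps)
    then show ?thesis using n(1) by (metis dvd_diffD dvd_refl)
  qed simp
qed

lemma coeff_sub_X1_scale: "coeff (sub f X1 (C2 b * X2)) n = [:b ^ n:] * coeff f n"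
proof -
  have "sub f X1 (C2 b * X2) = pcompose f [:0, [:b:]:]"
  proof (rule rhom_eqI2[where \<theta> = "\<lambda>f. sub f X1 (C2 b * X2)"])
    show "rhom (\<lambda>p. pcompose p [:0, [:b:]:])"
      by (rule rhomI) (simp_all add: pcompose_add pcompose_mult pcompose_1)
  qed (simp_all add: rhom_sub sub_simps, simp_all add: C2_def X1_def X2_def pcompose_pCons)
  then show ?thesis by (simp add: coeff_pcompose_linear poly_const_pow)
qed

text \<open>Induction on the degree in x2. Translations and scalings make f(0, x2) a polynomial in
  x2^(q(q-1)), the restriction of \<open>dickson2 1\<close>. Subtracting the same polynomial in
  \<open>dickson2 1\<close> leaves an invariant vanishing on x1 = 0, hence \<open>dickson2 0\<close>
  times an invariant of smaller degree.\<close>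

theorem Inv_eq_D2: "(Inv :: 'a::{finite,field} poly poly set) = D2"
proof
  show "D2 \<subseteq> (Inv :: 'a poly poly set)" by (rule D2_subset_Inv)
  show "(Inv :: 'a poly poly set) \<subseteq> D2"
  proof
    fix f :: "'a poly poly" assume "f \<in> Inv"
    then show "f \<in> D2"
    proof (induction "degree f" arbitrary: f rule: less_induct)
      case less
      let ?q = "CARD('a)" and ?N = "CARD('a) * (CARD('a) - 1)"
      have q: "?q \<ge> 2" by (rule card_field_ge_2)
      define \<phi> where "\<phi> n = poly (coeff f n) 0" for n
      have shift: "sub f X1 (X2 + C2 b * X1) = f" for b
        using InvD[OF less.prems, of 1 1 0 b] by (simp add: lin_def rhom_simps[OF rhom_C2] add.commute)
      have scale: "sub f X1 (C2 b * X2) = f" if "b \<noteq> 0" for b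
        using InvD[OF less.prems, of 1 b 0 0] that by (simp add: lin_def rhom_simps[OF rhom_C2])
      have N: "?N dvd n" if "\<phi> n \<noteq> 0" for n
      proof (rule divides_mult)
        show "?q dvd n" using translation_invariant_coeff[OF shift] that by (simp add: \<phi>_def)
        show "(?q - 1) dvd n"
        proof (rule power_eq_one_imp_dvd)
          fix b :: 'a assume "b \<noteq> 0"
          then have "poly ([:b ^ n:] * coeff f n) 0 = \<phi> n"
            using coeff_sub_X1_scale[of f b n] scale[of b] by (simp add: \<phi>_def)
          then show "b ^ n = 1" using that by (simp add: \<phi>_def)
        qed
        show "coprime ?q (?q - 1)" using q coprime_diff_one_right_nat[of ?q] by simp
      qed
      define G where "G = (\<Sum>n\<le>degree f. C2 (\<phi> n) * dickson2 1 ^ (n div ?N))"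
      have G: "G \<in> D2" unfolding G_def by (intro D2_sum D2_mult D2_C2 D2_power D2_dickson2_1)
      have "sub G 0 X2 = (\<Sum>n\<le>degree f. C2 (\<phi> n) * (X2 ^ ?N) ^ (n div ?N))"
        unfolding G_def sub_simps by (simp only: sub_dickson2_1)
      also have "\<dots> = (\<Sum>n\<le>degree f. C2 (\<phi> n) * X2 ^ n)"
      proof (rule sum.cong[OF refl])
        fix n
        show "C2 (\<phi> n) * (X2 ^ ?N) ^ (n div ?N) = C2 (\<phi> n) * X2 ^ n"
        proof (cases "\<phi> n = 0")
          case False
          have "?N * (n div ?N) = n" by (rule dvd_mult_div_cancel[OF N[OF False]])
          then show ?thesis by (simp only: power_mult[symmetric])
        qed (simp add: rhom_0[OF rhom_C2])
      qed
      also have "\<dots> = sub f 0 X2" by (simp add: sub_0_X2_eq_sum \<phi>_def)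
      finally have 0: "sub (f - G) 0 X2 = 0" by (simp add: sub_simps)
      have I: "f - G \<in> Inv" using G D2_subset_Inv less.prems by (blast intro: Inv_diff)
      then obtain k where k: "f - G = L2 ^ (?q - 1) * k" using Inv_dvd[OF I 0] by (auto simp: dvd_def)
      have "k \<in> D2"
      proof (cases "k = 0")
        case False
        \<comment> \<open>\<open>dickson2 1\<close> has degree exactly q(q-1) in x2, so subtracting
          \<open>G\<close> does not raise the degree.\<close>
        have "degree (C2 (\<phi> n) * dickson2 1 ^ (n div ?N)) \<le> degree f" if "n \<le> degree f" for n
        proof (cases "\<phi> n = 0")
          case False
          have "degree (C2 (\<phi> n) * dickson2 1 ^ (n div ?N)) \<le> degree (dickson2 1 ^ (n div ?N) :: 'a poly poly)"
            using degree_mult_le[of "C2 (\<phi> n)" "dickson2 1 ^ (n div ?N)"] by (simp add: C2_def)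
          also have "\<dots> \<le> ?N * (n div ?N)" using degree_power_le[of "dickson2 1 :: 'a poly poly" "n div ?N"] by (simp only: degree_dickson2_1)
          also have "\<dots> = n" by (rule dvd_mult_div_cancel[OF N[OF False]])
          finally show ?thesis using that by simp
        qed (simp add: rhom_0[OF rhom_C2])
        then have "degree G \<le> degree f" unfolding G_def by (intro degree_sum_le) auto
        then have "degree (L2 ^ (?q - 1) * k) \<le> degree f" unfolding k[symmetric] by (intro degree_diff_le) auto
        moreover have "degree (L2 ^ (?q - 1) * k) = (?q - 1) * ?q + degree k"
        proof -
          have "degree (L2 :: 'a poly poly) = ?q"
            by (simp add: L2_eq_zf degree_mult_eq X1_nz zf_nz zf_degree) (simp add: X1_def)
          then show ?thesis using False by (simp add: degree_mult_eq L2_nz degree_power_eq)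
        qed
        moreover have "(?q - 1) * ?q > 0" using q by simp
        ultimately have "degree k < degree f" by linarith
        moreover have "k \<in> Inv"
        proof (rule Inv_cancel)
          show "L2 ^ (?q - 1) * k \<in> Inv" using I by (simp only: k)
          show "L2 ^ (?q - 1) \<in> (Inv :: 'a poly poly set)" using dickson2_in_Inv[of 0] by (simp only: dickson2_0)
          show "L2 ^ (?q - 1) \<noteq> (0 :: 'a poly poly)" using L2_nz[where 'a='a] by simp
        qed
        ultimately show ?thesis by (rule less.hyps)
      qed (simp add: D2_0)
      then have "G + dickson2 0 * k \<in> D2" by (intro D2_add G D2_mult D2_dickson2_0)
      then show ?case using k by (simp add: dickson2_0 algebra_simps)
    qed
  qed
qed

section \<open>Interpolation\<close>

text \<open>The points of the span fall into the clusters \<open>b x\<^sub>2 + F\<^sub>q x\<^sub>1\<close>. On a cluster the prescribed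
  values are those of a polynomial with integral coefficients, and clusters are separated by the value
  \<open>b z\<close> of \<open>X^q - x\<^sub>1^(q-1) X\<close>. The Chinese remainder theorem thus interpolates with denominator
  \<open>z^(q-1)\<close> only; Lagrange interpolation at the individual points would give a larger one.\<close>

lemma interpolation:
  fixes H :: "'a::{finite,field} poly poly"
  obtains P :: "'a poly poly poly"
  where "degree P < CARD('a) ^ 2"
    "\<And>a b. poly P (lin a b) = zf ^ (CARD('a) - 1) * sub H (C2 a * X1) (C2 b * X2)"
proof -
  let ?q = "CARD('a)"
  have q: "?q \<ge> 2" by (rule card_field_ge_2)
  \<comment> \<open>\<open>Z b\<close> is monic of degree q and vanishes exactly on the cluster of
    \<open>b\<close> among the points of the span.\<close>
  define Z :: "'a \<Rightarrow> 'a poly poly poly"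
    where "Z b = monom 1 ?q - monom (X1 ^ (?q - 1)) 1 - [:C2 b * zf:]" for b
  have poly_Z: "poly (Z c) (lin a b) = C2 (b - c) * zf" for a b c
  proof -
    have "X1 ^ (?q - 1) * X1 = (X1 ^ ?q :: 'a poly poly)" by (rule power_minus_1_mult_card)
    then show ?thesis
      by (simp add: Z_def poly_monom lin_power_card rhom_diff[OF rhom_C2])
         (simp add: zf_def lin_def algebra_simps)
  qed
  have coeff_Z: "coeff (Z b) ?q = 1" for b
    using q by (simp add: Z_def coeff_pCons split: nat.splits)
  have "degree (Z b) \<le> ?q" for b
    unfolding Z_def using q by (intro degree_diff_le) (auto intro: order_trans[OF degree_monom_le])
  moreover have "degree (Z b) \<ge> ?q" for b using coeff_Z[of b] by (intro le_degree) simp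
  ultimately have deg_Z: "degree (Z b) = ?q" for b by (rule antisym)
  \<comment> \<open>At the point a x1 + b x2, the argument X - b x2 recovers a x1; so
    \<open>W b\<close> has the prescribed value on the cluster of \<open>b\<close>, but uncontrolled
    degree.\<close>
  define W where "W b = ev2 C3 H ([:0, 1:] - [:C2 b * X2:]) [:C2 b * X2:]" for b
  have C3: "poly (C3 c) x = C2 c" for c :: 'a and x by (simp add: C3_eq)
  have poly_W: "poly (W b) x = sub H (x - C2 b * X2) (C2 b * X2)" for b x
    unfolding W_def rhom_ev2_apply[OF rhom_poly rhom_C3] by (simp add: C3)
  have "\<exists>r. degree r < ?q \<and> (\<forall>a. poly r (lin a b) = poly (W b) (lin a b))" for b
  proof -
    obtain K r where pdm: "pseudo_divmod (W b) (Z b) = (K, r)" by fastforce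
    have Z0: "Z b \<noteq> 0" using coeff_Z[of b] by auto
    have "W b = Z b * K + r" and r: "r = 0 \<or> degree r < degree (Z b)"
      using pseudo_divmod[OF Z0 pdm] coeff_Z[of b] by (auto simp: deg_Z)
    then have "poly r (lin a b) = poly (W b) (lin a b)" for a
      by (simp add: poly_Z rhom_0[OF rhom_C2])
    moreover have "degree r < ?q" using r q by (auto simp: deg_Z)
    ultimately show ?thesis by blast
  qed
  then obtain r where r: "\<And>b. degree (r b) < ?q" "\<And>a b. poly (r b) (lin a b) = poly (W b) (lin a b)" by metis
  \<comment> \<open>On the cluster of \<open>b\<close> the product of the other \<open>Z c\<close>
    equals \<open>\<kappa> b\<close> times z^(q-1). The factor \<open>\<kappa> b\<close> is a
    nonzero scalar and can be inverted.\<close>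
  define \<kappa> :: "'a \<Rightarrow> 'a" where "\<kappa> b = (\<Prod>c\<in>UNIV - {b}. b - c)" for b
  have \<kappa>: "\<kappa> b \<noteq> 0" for b by (auto simp: \<kappa>_def)
  define P where "P = (\<Sum>b\<in>UNIV. [:C2 (inverse (\<kappa> b)):] * ((\<Prod>c\<in>UNIV - {b}. Z c) * r b))"
  show thesis
  proof (rule that)
    have "degree ([:C2 (inverse (\<kappa> b)):] * ((\<Prod>c\<in>UNIV - {b}. Z c) * r b)) \<le> ?q ^ 2 - 1" for b
    proof -
      have "degree (\<Prod>c\<in>UNIV - {b}. Z c) \<le> (\<Sum>c\<in>UNIV - {b}. degree (Z c))"
        using degree_prod_sum_le[of "UNIV - {b}" Z] by (simp add: o_def)
      also have "\<dots> = (?q - 1) * ?q" by (simp add: deg_Z card_Diff_singleton)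
      finally have "degree ((\<Prod>c\<in>UNIV - {b}. Z c) * r b) \<le> (?q - 1) * ?q + (?q - 1)"
        using degree_mult_le[of "\<Prod>c\<in>UNIV - {b}. Z c" "r b"] r(1)[of b] by linarith
      also have "\<dots> = ?q ^ 2 - 1" using q by (simp add: power2_eq_square algebra_simps)
      finally show ?thesis using degree_smult_le order_trans by fastforce
    qed
    then have "degree P \<le> ?q ^ 2 - 1" unfolding P_def by (intro degree_sum_le) auto
    then show "degree P < ?q ^ 2" using q by (simp add: le_less_trans less_le_trans power2_eq_square)
  next
    fix a b
    have "poly P (lin a b) = (\<Sum>b'\<in>UNIV. C2 (inverse (\<kappa> b')) * ((\<Prod>c\<in>UNIV - {b'}. C2 (b - c) * zf) * poly (r b') (lin a b)))"
      by (simp add: P_def poly_sum poly_prod poly_Z)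
    also have "\<dots> = (\<Sum>b'\<in>{b}. C2 (inverse (\<kappa> b')) * ((\<Prod>c\<in>UNIV - {b'}. C2 (b - c) * zf) * poly (r b') (lin a b)))"
    proof (rule sum.mono_neutral_right)
      show "\<forall>i\<in>UNIV - {b}. C2 (inverse (\<kappa> i)) * ((\<Prod>c\<in>UNIV - {i}. C2 (b - c) * zf) * poly (r i) (lin a b)) = 0"
      proof
        fix i assume "i \<in> UNIV - {b}"
        then have "(\<Prod>c\<in>UNIV - {i}. C2 (b - c) * zf) = 0"
          by (intro prod_zero) (auto intro!: bexI[of _ b] simp: rhom_0[OF rhom_C2])
        then show "C2 (inverse (\<kappa> i)) * ((\<Prod>c\<in>UNIV - {i}. C2 (b - c) * zf) * poly (r i) (lin a b)) = 0" by simp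
      qed
    qed auto
    also have "\<dots> = C2 (inverse (\<kappa> b)) * C2 (\<kappa> b) * (zf ^ (?q - 1) * poly (r b) (lin a b))"
      by (simp add: prod.distrib \<kappa>_def rhom_prod[OF rhom_C2] card_Diff_singleton mult_ac)
    also have "C2 (inverse (\<kappa> b)) * C2 (\<kappa> b) = 1"
      using \<kappa> by (simp add: rhom_1[OF rhom_C2] flip: rhom_mult[OF rhom_C2])
    also have "poly (r b) (lin a b) = sub H (C2 a * X1) (C2 b * X2)"
      by (simp add: r(2) poly_W) (simp add: lin_def)
    finally show "poly P (lin a b) = zf ^ (?q - 1) * sub H (C2 a * X1) (C2 b * X2)" by simp
  qed
qed

text \<open>P(c X) - c P(X) has degree below q^2 and vanishes on the q^2 points of the span, so it
  is zero. Thus c^i = c for every scalar c and every exponent i in the support.\<close>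

lemma homogeneous_coeff:
  fixes P :: "'a::{finite,field} poly poly poly"
  assumes "degree P < CARD('a) ^ 2" "\<And>c u. u \<in> span2 \<Longrightarrow> poly P (C2 c * u) = C2 c * poly P u"
    and "coeff P i \<noteq> 0"
  shows "\<exists>s\<le>CARD('a). i = s * (CARD('a) - 1) + 1"
proof -
  let ?q = "CARD('a)"
  have q: "?q \<ge> 2" by (rule card_field_ge_2)
  have c: "c ^ i = c" for c :: 'a
  proof -
    let ?R = "pcompose P [:0, C2 c:] - smult (C2 c) P"
    have "degree (pcompose P [:0, C2 c:]) \<le> degree P"
      using degree_pcompose_le[of P "[:0, C2 c:]"] by (auto intro: order_trans)
    then have "degree ?R \<le> degree P" using degree_smult_le by (intro degree_diff_le)
    then have "?R = 0" using assms(1,2)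
      by (intro poly_eq_0_by_roots[OF finite_span2]) (auto simp: card_span2 poly_pcompose mult.commute)
    then have "coeff ?R i = 0" by simp
    then have "C2 (c ^ i - c) * coeff P i = 0"
      by (simp add: coeff_pcompose_linear rhom_simps[OF rhom_C2] algebra_simps)
    then show ?thesis using assms(3) by (simp add: rhom_eq_0_iff[OF rhom_C2])
  qed
  \<comment> \<open>The scalar 0 rules out the constant term, which makes \<open>i - 1\<close> below
    a true predecessor.\<close>
  have i0: "i \<noteq> 0" using c[of 0] by (cases i) auto
  have "(?q - 1) dvd (i - 1)"
  proof (rule power_eq_one_imp_dvd)
    fix b :: 'a assume "b \<noteq> 0"
    moreover have "b ^ i = b * b ^ (i - 1)" using i0 by (simp flip: power_Suc)
    ultimately show "b ^ (i - 1) = 1" using c[of b] by simp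
  qed
  then obtain s where s: "i - 1 = s * (?q - 1)" by (metis dvd_def mult.commute)
  have "i \<le> degree P" using assms(3) by (rule le_degree)
  then have "s * (?q - 1) < ?q ^ 2 - 1" using assms(1) i0 s by linarith
  also have "?q ^ 2 - 1 = (?q + 1) * (?q - 1)" using q by (simp add: power2_eq_square algebra_simps)
  finally have "s < ?q + 1" by (rule mult_less_cancel2[THEN iffD1, THEN conjunct2])
  then show ?thesis using s i0 by (intro exI[of _ s]) auto
qed

lemma inj_exponent: "inj_on (\<lambda>s. s * (CARD('a::{finite,field}) - 1) + 1) S"
  using card_field_ge_2[where 'a='a] by (auto simp: inj_on_def)

lemma homogeneous_poly:
  fixes P :: "'a::{finite,field} poly poly poly"
  assumes "degree P < CARD('a) ^ 2" "\<And>c u. u \<in> span2 \<Longrightarrow> poly P (C2 c * u) = C2 c * poly P u"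
  shows "poly P x = (\<Sum>s\<le>CARD('a). coeff P (s * (CARD('a) - 1) + 1) * x ^ (s * (CARD('a) - 1) + 1))"
proof -
  let ?q = "CARD('a)" and ?e = "\<lambda>s. s * (CARD('a) - 1) + 1"
  have "poly P x = (\<Sum>i\<le>degree P. coeff P i * x ^ i)" by (rule poly_altdef)
  also have "\<dots> = (\<Sum>i\<in>?e ` {..?q}. coeff P i * x ^ i)"
  proof (rule sum.mono_neutral_cong)
    fix i assume "i \<in> {..degree P} - ?e ` {..?q}"
    then have "coeff P i = 0" using homogeneous_coeff[OF assms, of i] by blast
    then show "coeff P i * x ^ i = 0" by simp
  qed (auto simp: coeff_eq_0)
  also have "\<dots> = (\<Sum>s\<le>?q. coeff P (?e s) * x ^ ?e s)"
    by (subst sum.reindex[OF inj_exponent]) simp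
  finally show ?thesis .
qed

section \<open>Coboundaries of power maps\<close>

lemma sub_Mnum:
  fixes u v :: "'a::{finite,field} poly poly"
  shows "sub (Mnum s) u v = u ^ (s * (CARD('a) - 1) + 1) + v ^ (s * (CARD('a) - 1) + 1)
     - (u + v) ^ (s * (CARD('a) - 1) + 1)"
  by (simp only: Mnum_def sub_simps)

text \<open>The exponents are 1 and q, and both powers are additive.\<close>

lemma sub_Mnum_0_1:
  fixes u v :: "'a::{finite,field} poly poly"
  shows "sub (Mnum 0) u v = 0" "sub (Mnum 1) u v = 0"
proof -
  have "1 * (CARD('a) - 1) + 1 = CARD('a)" using card_field_ge_2[where 'a='a] by simp
  then show "sub (Mnum 1) u v = 0" by (simp only: sub_Mnum frobenius_add[OF rhom_C2]) simp
qed (simp add: sub_Mnum)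

text \<open>The hypothesis makes S(X) = \<Sum> e_s X^(s(q-1)+1) F_q-linear on the span. Up to the
  factor \<open>L2\<close>, such a map is a combination of X and X^q; degrees are below q^2, so this
  is a polynomial identity, and all exponents with s \<ge> 2 exceed q.\<close>

lemma Mnum_independent:
  fixes e :: "nat \<Rightarrow> 'a::{finite,field} poly poly"
  assumes "\<And>u v. u \<in> span2 \<Longrightarrow> v \<in> span2 \<Longrightarrow> (\<Sum>s=2..CARD('a). e s * sub (Mnum s) u v) = 0"
    and s: "s \<in> {2..CARD('a)}"
  shows "e s = 0"
proof -
  let ?q = "CARD('a)" and ?e = "\<lambda>s. s * (CARD('a) - 1) + 1"
  have q: "?q \<ge> 2" by (rule card_field_ge_2)
  define S where "S = (\<Sum>s=2..?q. monom (e s) (?e s))"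
  have poly_S: "poly S x = (\<Sum>s=2..?q. e s * x ^ ?e s)" for x by (simp add: S_def poly_sum poly_monom)
  have add: "poly S (u + v) = poly S u + poly S v" if "u \<in> span2" "v \<in> span2" for u v
    using assms(1)[OF that] by (simp add: poly_S sub_Mnum algebra_simps sum.distrib sum_subtractf)
  have "C2 c ^ ?e s = C2 c" for c :: 'a and s
    by (simp only: rhom_power[OF rhom_C2, symmetric] power_mult_card_minus_1)
  then have scale: "poly S (C2 c * u) = C2 c * poly S u" for c u
    unfolding poly_S power_mult_distrib by (simp only: sum_distrib_left mult_ac)
  have lin: "poly S (lin a b) = C2 a * poly S X1 + C2 b * poly S X2" for a b
  proof -
    have "C2 b * X2 \<in> span2" by (simp only: C2_X2_eq_lin lin_in_span2)
    then show ?thesis unfolding lin_def by (simp only: add[OF C2_X1_in_span2] scale)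
  qed
  \<comment> \<open>Cramer's rule for \<alpha> u + \<beta> u^q = L2 S(u) at u = x1 and u =
    x2.\<close>
  define \<alpha> where "\<alpha> = poly S X1 * X2 ^ ?q - poly S X2 * X1 ^ ?q"
  define \<beta> where "\<beta> = X1 * poly S X2 - X2 * poly S X1"
  define R where "R = smult L2 S - monom \<alpha> 1 - monom \<beta> ?q"
  have "?q * (?q - 1) + 1 < ?q ^ 2"
  proof -
    obtain k where k: "?q = k + 2" using q by (metis le_Suc_ex add.commute)
    show ?thesis unfolding k by (simp add: power2_eq_square)
  qed
  moreover have "degree S \<le> ?q * (?q - 1) + 1"
    unfolding S_def by (intro degree_sum_le) (auto intro!: order_trans[OF degree_monom_le] mult_right_mono)
  moreover have "?q \<le> ?q * (?q - 1) + 1"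
    using q mult_le_mono2[of 1 "?q - 1" ?q] by linarith
  ultimately have n: "?q * (?q - 1) + 1 < ?q ^ 2" "degree S \<le> ?q * (?q - 1) + 1" "?q \<le> ?q * (?q - 1) + 1"
    by blast+
  have "degree R \<le> ?q * (?q - 1) + 1"
    unfolding R_def
  proof (intro degree_diff_le)
    show "degree (smult L2 S) \<le> ?q * (?q - 1) + 1"
      using degree_smult_le n(2) by (rule order_trans)
    show "degree (monom \<alpha> 1) \<le> ?q * (?q - 1) + 1"
      by (rule order_trans[OF degree_monom_le]) simp
    show "degree (monom \<beta> ?q) \<le> ?q * (?q - 1) + 1"
      using degree_monom_le n(3) by (rule order_trans)
  qed
  then have "degree R < ?q ^ 2" using n(1) by (rule le_less_trans)
  moreover have "poly R u = 0" if "u \<in> span2" for u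
  proof -
    from that obtain a b where u: "u = lin a b" by (rule span2_cases)
    show ?thesis unfolding R_def u
      by (simp add: poly_monom lin lin_power_card) (simp add: lin_def \<alpha>_def \<beta>_def L2_eq algebra_simps)
  qed
  ultimately have "R = 0" by (intro poly_eq_0_by_roots[OF finite_span2]) (simp_all add: card_span2)
  then have R0: "coeff R (?e s) = 0" by simp
  have "?e s > ?q"
  proof -
    have "2 * (?q - 1) \<le> s * (?q - 1)" using s by (intro mult_right_mono) auto
    then show ?thesis using q by linarith
  qed
  moreover have "coeff S (?e s) = e s"
  proof -
    have "coeff S (?e s) = (\<Sum>s'=2..?q. if s' = s then e s' else 0)"
      unfolding S_def coeff_sum coeff_monom
      by (intro sum.cong refl if_cong) (rule inj_eq[OF inj_exponent[where 'a='a]])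
    then show ?thesis using s by simp
  qed
  ultimately have "L2 * e s = 0" using R0 q s by (simp add: R_def)
  then show ?thesis using L2_nz[where 'a='a] by simp
qed

section \<open>The difference map\<close>

lemma sub_L2_X1_plus_X2: "sub L2 (X1 + X2) X2 = L2"
  using sub_L2_lin[of 1 1 0 1] by (simp add: lin_def rhom_simps[OF rhom_C2])

text \<open>Divisibility by a power of x2 means vanishing of the lowest coefficients, and x1^j only
  rescales coefficients.\<close>

lemma X2_power_dvd_cancel:
  fixes k :: "'a::{finite,field} poly poly"
  assumes "X2 ^ n dvd X1 ^ j * k"
  shows "X2 ^ n dvd k"
proof -
  have X2: "X2 ^ n = monom (1 :: 'a poly) n" by (simp add: X2_def monom_altdef)
  have X1: "X1 ^ j * k = smult ([:0, 1:] ^ j) k" by (simp add: X1_def poly_const_pow)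
  show ?thesis using assms unfolding X2 X1 monom_1_dvd_iff' by simp
qed

text \<open>Both \<open>f * L2\<close> and \<open>L2\<close> change sign under the exchange of
  variables.\<close>

lemma A2_sym:
  fixes f :: "'a::{finite,field} poly poly"
  assumes "f \<in> A2 m"
  shows "sub f v u = sub f u v"
proof -
  have "sub (f * L2) X2 X1 = - sub (f * L2) X1 X2"
    by (rule pluecker_skew[OF iffD1[OF A2_iff assms] refl])
  moreover have "sub L2 X2 X1 = - (L2 :: 'a poly poly)" by (simp add: sub_L2) (simp add: L2_eq)
  ultimately have "sub f X2 X1 = f"
    using L2_nz[where 'a='a] by (simp add: sub_simps sub_X1_X2)
  then have "sub (sub f X2 X1) u v = sub f u v" by simp
  then show ?thesis by (simp only: sub_sub sub_simps)
qed

lemma A2_scale: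
  fixes f :: "'a::{finite,field} poly poly"
  assumes "f \<in> A2 m" "b \<noteq> 0"
  shows "sub f (C2 b * u) v = sub f u v"
proof -
  have "sub (f * L2) (C2 b * X1) X2 = C2 b * sub (f * L2) X1 X2"
    by (rule pluecker_scale[OF iffD1[OF A2_iff assms(1)] refl])
  moreover have "sub L2 (C2 b * X1) X2 = C2 b * (L2 :: 'a poly poly)"
    by (simp add: sub_L2 power_mult_distrib C2_power_card) (simp add: L2_eq algebra_simps)
  ultimately have "C2 b * L2 * sub f (C2 b * X1) X2 = C2 b * L2 * f"
    by (simp add: sub_simps sub_X1_X2 mult_ac)
  then have "sub f (C2 b * X1) X2 = f"
    using L2_nz[where 'a='a] assms(2) rhom_eq_0_iff[OF rhom_C2, of b] by simp
  then have "sub (sub f (C2 b * X1) X2) u v = sub f u v" by simp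
  then show ?thesis by (simp add: sub_sub sub_simps)
qed

text \<open>The relation at (x1, x2, x1+x2), divided by \<open>L2\<close> and rewritten by symmetry
  of \<open>f\<close>, shows that x1^Q times the difference is a multiple of x2^Q; then x1^Q
  cancels.\<close>

lemma A2_difference_dvd:
  fixes f :: "'a::{finite,field} poly poly"
  assumes f: "f \<in> A2 m"
  shows "X2 ^ (CARD('a) ^ m) dvd f - sub f (X1 + X2) X2"
proof -
  let ?Q = "CARD('a) ^ m" and ?w = "X1 + X2 :: 'a poly poly"
  have w: "?w = lin 1 1" by (simp add: lin_def rhom_1[OF rhom_C2])
  have pl: "pluecker m (f * L2)" using f by (simp add: A2_iff)
  have eq: "X2 ^ ?Q * sub (f * L2) X1 ?w = X1 ^ ?Q * sub (f * L2) X2 ?w + ?w ^ ?Q * sub (f * L2) X1 X2"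
    by (rule plueckerD[OF pl X1_in_span2 X2_in_span2]) (simp add: w lin_in_span2)
  have "sub L2 X1 ?w = (L2 :: 'a poly poly)" "sub L2 X2 ?w = - L2"
    by (simp_all add: sub_L2 frobenius_add[OF rhom_C2]) (simp_all add: L2_eq algebra_simps)
  then have "L2 * (X2 ^ ?Q * sub f X1 ?w) = L2 * (- (X1 ^ ?Q) * sub f X2 ?w + (X1 ^ ?Q + X2 ^ ?Q) * f)"
    using eq by (simp add: sub_simps sub_X1_X2 frobenius_add_power[OF rhom_C2] algebra_simps)
  then have "X2 ^ ?Q * sub f X1 ?w = - (X1 ^ ?Q) * sub f X2 ?w + (X1 ^ ?Q + X2 ^ ?Q) * f"
    by (rule mult_left_cancel[OF L2_nz, THEN iffD1])
  then have "X1 ^ ?Q * (f - sub f ?w X2) = X2 ^ ?Q * (sub f X1 ?w - f)"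
    unfolding A2_sym[OF f, of X2 ?w] by (simp add: algebra_simps)
  then have "X2 ^ ?Q dvd X1 ^ ?Q * (f - sub f ?w X2)" by simp
  then show ?thesis by (rule X2_power_dvd_cancel)
qed

section \<open>Kernel of the difference map and module structure\<close>

lemma Inv_sub_X1_plus_X2: "c \<in> Inv \<Longrightarrow> sub c (X1 + X2) X2 = c"
  using InvD[of c 1 1 1 0] by (simp add: lin_def rhom_simps[OF rhom_C2])

text \<open>Elements of \<open>A2 m\<close> are already symmetric and insensitive to scaling either
  variable. Adding the transvection x1 -> x1 + x2 yields generators of GL_2, and row reduction
  reaches every matrix.\<close>

lemma A2_Inv:
  fixes f :: "'a::{finite,field} poly poly"
  assumes f: "f \<in> A2 m" and fix_f: "sub f (X1 + X2) X2 = f"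
  shows "f \<in> Inv"
proof -
  have shift1: "sub f (u + v) v = sub f u v" for u v
  proof -
    have "sub (sub f (X1 + X2) X2) u v = sub f u v" by (simp add: fix_f)
    then show ?thesis by (simp add: sub_sub sub_simps)
  qed
  note sym = A2_sym[OF f]
  have scale': "sub f u (C2 b * v) = sub f u v" if "b \<noteq> 0" for b u v
    by (subst (1 2) sym) (rule A2_scale[OF f that])
  have shift: "sub f (u + C2 b * v) v = sub f u v" for b u v
  proof (cases "b = 0")
    case False
    have "sub f (u + C2 b * v) v = sub f (u + C2 b * v) (C2 b * v)" by (rule scale'[OF False, symmetric])
    also have "\<dots> = sub f u v" by (subst shift1) (rule scale'[OF False])
    finally show ?thesis .
  qed (simp add: rhom_0[OF rhom_C2])
  have upper: "sub f (lin a b) (lin c d) = f" if "a * d - b * c \<noteq> 0" "a \<noteq> 0" for a b c d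
  proof -
    \<comment> \<open>Eliminates x1 from the second row; the remaining pivot is the determinant
      divided by \<open>a\<close>.\<close>
    have "lin c d = lin 0 (d - b * c / a) + C2 (c / a) * lin a b"
      using that by (simp add: C2_mult_lin lin_add mult.commute[of b c])
    then have "sub f (lin c d) (lin a b) = sub f (lin 0 (d - b * c / a)) (lin a b)"
      by (simp only: shift)
    then have "sub f (lin a b) (lin c d) = sub f (lin a b) (lin 0 (d - b * c / a))"
      by (simp only: sym[of "lin a b" "lin c d"] sym[of "lin a b" "lin 0 (d - b * c / a)"])
    also have "lin 0 (d - b * c / a) = C2 (d - b * c / a) * X2" by (simp add: C2_X2_eq_lin)
    also have "sub f (lin a b) \<dots> = sub f (lin a b) X2"
      using that by (intro scale') (simp add: field_simps)
    also have "\<dots> = sub f (C2 a * X1) X2" by (simp add: lin_def shift)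
    also have "\<dots> = f" using A2_scale[OF f that(2)] by (simp add: sub_X1_X2)
    finally show ?thesis .
  qed
  show ?thesis
  proof (rule InvI)
    fix a b c d :: 'a assume *: "a * d - b * c \<noteq> 0"
    show "sub f (lin a b) (lin c d) = f"
    proof (cases "a = 0")
      case True
      with * have "c * b - d * a \<noteq> 0" "c \<noteq> 0" by auto
      then have "sub f (lin c d) (lin a b) = f" by (rule upper)
      then show ?thesis by (simp only: sym[of "lin c d" "lin a b"])
    qed (use upper * in blast)
  qed
qed

text \<open>On independent pairs \<open>c\<close> takes its own value by invariance; on dependent
  pairs \<open>L2\<close> vanishes. So the whole relation is multiplied by \<open>c\<close>.\<close>

lemma pluecker_Inv_mult:
  fixes f c :: "'a::{finite,field} poly poly"
  assumes "pluecker m (f * L2)" "c \<in> Inv"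
  shows "pluecker m (c * f * L2)"
proof -
  have *: "sub (c * f * L2) u v = c * sub (f * L2) u v" if uv: "u \<in> span2" "v \<in> span2" for u v
  proof -
    from uv obtain a b d e where eq: "u = lin a b" "v = lin d e" by (metis span2_cases)
    show ?thesis
    proof (cases "a * e - b * d = 0")
      case True
      then show ?thesis by (simp add: sub_simps eq sub_L2_lin rhom_0[OF rhom_C2])
    next
      case False
      then show ?thesis using InvD[OF assms(2) False] by (simp add: sub_simps eq mult_ac)
    qed
  qed
  show ?thesis unfolding pluecker_def
  proof (intro ballI)
    fix u v w :: "'a poly poly" assume uvw: "u \<in> span2" "v \<in> span2" "w \<in> span2"
    have "c * (v ^ (CARD('a) ^ m) * sub (f * L2) u w) =
       c * (u ^ (CARD('a) ^ m) * sub (f * L2) v w + w ^ (CARD('a) ^ m) * sub (f * L2) u v)"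
      by (simp only: plueckerD[OF assms(1) uvw])
    then show "v ^ (CARD('a) ^ m) * sub (c * f * L2) u w
      = u ^ (CARD('a) ^ m) * sub (c * f * L2) v w + w ^ (CARD('a) ^ m) * sub (c * f * L2) u v"
      using uvw by (simp only: *) (simp add: algebra_simps)
  qed
qed

lemma A2_add: "f \<in> A2 m \<Longrightarrow> g \<in> A2 m \<Longrightarrow> f + g \<in> A2 m"
  by (simp add: A2_iff distrib_right pluecker_add)

lemma A2_D2_mult: "c \<in> D2 \<Longrightarrow> f \<in> A2 m \<Longrightarrow> c * f \<in> A2 m"
  using pluecker_Inv_mult by (auto simp: A2_iff Inv_eq_D2)

lemma A2_sum:
  assumes "\<And>i. i \<in> I \<Longrightarrow> h i \<in> A2 m"
  shows "(\<Sum>i\<in>I. h i) \<in> A2 m"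
  using assms by (induction I rule: infinite_finite_induct) (auto simp: A2_iff pluecker_0 distrib_right pluecker_add)

text \<open>On the span \<open>L2\<close> is a determinant times a constant factor and the Q-th
  power is linear: the relation is the linear dependence of three vectors in a plane, with 2 x 2
  minors as coefficients.\<close>

lemma one_in_A2: "1 \<in> A2 m"
proof -
  have "pluecker m (L2 :: 'a poly poly)"
    unfolding pluecker_def
  proof (intro ballI)
    fix u v w :: "'a poly poly" assume "u \<in> span2" "v \<in> span2" "w \<in> span2"
    then obtain a b c d e g where "u = lin a b" "v = lin c d" "w = lin e g" by (metis span2_cases)
    then show "v ^ (CARD('a) ^ m) * sub L2 u w = u ^ (CARD('a) ^ m) * sub L2 v w + w ^ (CARD('a) ^ m) * sub L2 u v"
      by (simp only: sub_L2_lin lin_power rhom_diff[OF rhom_C2] rhom_mult[OF rhom_C2]) (simp add: algebra_simps)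
  qed
  then show ?thesis by (simp add: A2_iff)
qed

text \<open>Up to the factor \<open>x\<^sub>2^(q^m)\<close>, the function \<open>h L\<^sub>2\<close> is the coboundary of \<open>u \<mapsto> (f L\<^sub>2)(u, x\<^sub>2)\<close>.\<close>

lemma A2_coboundary:
  fixes f h u v :: "'a::{finite,field} poly poly"
  assumes f: "f \<in> A2 m" and h: "f - sub f (X1 + X2) X2 = X2 ^ (CARD('a) ^ m) * h"
    and u: "u \<in> span2" and v: "v \<in> span2"
  shows "X2 ^ (CARD('a) ^ m) * sub (h * L2) u v = sub (f * L2) u X2 + sub (f * L2) v X2 - sub (f * L2) (u + v) X2"
proof -
  let ?Q = "CARD('a) ^ m"
  define F where "F = f * L2"
  define g where "g u = sub F u X2" for u
  have pl: "pluecker m F" using f by (simp add: A2_iff F_def)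
  \<comment> \<open>The relation with middle argument x2 recovers \<open>F\<close> from the
    one-variable function \<open>g\<close>.\<close>
  have X2F: "X2 ^ ?Q * sub F u v = v ^ ?Q * g u - u ^ ?Q * g v" if "u \<in> span2" "v \<in> span2" for u v
    using plueckerD[OF pl that(1) X2_in_span2 that(2)] pluecker_skew[OF pl F_def, of v X2]
    by (simp add: g_def)
  have uv: "u + v \<in> span2" using u v by (auto elim!: span2_cases simp: lin_add lin_in_span2)
  have "F - sub F (X1 + X2) X2 = X2 ^ ?Q * (h * L2)"
    using h by (simp add: F_def sub_simps sub_L2_X1_plus_X2 left_diff_distrib[symmetric])
  then have "sub (F - sub F (X1 + X2) X2) u v = sub (X2 ^ ?Q * (h * L2)) u v" by simp
  then have eq: "sub F u v - sub F (u + v) v = v ^ ?Q * sub (h * L2) u v"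
    unfolding rhom_diff[OF rhom_sub] sub_sub unfolding sub_simps by simp
  have "v ^ ?Q * (X2 ^ ?Q * sub (h * L2) u v) = X2 ^ ?Q * (sub F u v - sub F (u + v) v)"
    unfolding eq by (rule mult.left_commute)
  also have "\<dots> = X2 ^ ?Q * sub F u v - X2 ^ ?Q * sub F (u + v) v"
    by (rule right_diff_distrib)
  also have "\<dots> = v ^ ?Q * (g u + g v - g (u + v))"
    by (simp only: X2F[OF u v] X2F[OF uv v] frobenius_add_power[OF rhom_C2]) (simp only: algebra_simps)
  finally have *: "v ^ ?Q * (X2 ^ ?Q * sub (h * L2) u v) = v ^ ?Q * (g u + g v - g (u + v))" .
  show ?thesis
  proof (cases "v = 0")
    case True
    have "sub L2 u 0 = 0" "sub L2 0 X2 = (0 :: 'a poly poly)"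
      using card_field_ge_2[where 'a='a] by (simp_all add: sub_L2 power_0_left)
    then show ?thesis unfolding True sub_simps by simp
  next
    case False
    then have "v ^ ?Q \<noteq> 0" by simp
    then have "X2 ^ ?Q * sub (h * L2) u v = g u + g v - g (u + v)"
      using * by (rule mult_left_cancel[THEN iffD1])
    then show ?thesis by (simp only: g_def F_def)
  qed
qed

section \<open>Expansion of the differences in the basis of M\<close>

lemma Mnum_L2_dvd: "L2 dvd (Mnum s :: 'a::{finite,field} poly poly)"
proof (rule L2_dvd)
  let ?e = "s * (CARD('a) - 1) + 1"
  show "sub (Mnum s) 0 X2 = (0 :: 'a poly poly)" by (simp add: sub_Mnum)
  fix b :: 'a
  have "C2 c ^ ?e = C2 c" for c :: 'a
    by (simp only: rhom_power[OF rhom_C2, symmetric] power_mult_card_minus_1)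
  moreover have "X1 + C2 b * X1 = C2 (1 + b) * X1" by (simp add: rhom_simps[OF rhom_C2] algebra_simps)
  ultimately have "sub (Mnum s) X1 (C2 b * X1) = X1 ^ ?e + C2 b * X1 ^ ?e - C2 (1 + b) * X1 ^ ?e"
    by (simp only: sub_Mnum power_mult_distrib)
  then show "sub (Mnum s) X1 (C2 b * X1) = 0" by (simp add: rhom_simps[OF rhom_C2] algebra_simps)
qed

text \<open>One relation at (x1, x2) with invariant coefficients transfers to all independent pairs
  of the span; on dependent pairs each \<open>Mnum s\<close> vanishes, being a multiple of
  \<open>L2\<close>.\<close>

lemma Mnum_independent_D2:
  fixes e :: "nat \<Rightarrow> 'a::{finite,field} poly poly"
  assumes e: "\<And>s. s \<in> {2..CARD('a)} \<Longrightarrow> e s \<in> D2" and 0: "(\<Sum>s=2..CARD('a). e s * Mnum s) = 0"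
    and s: "s \<in> {2..CARD('a)}"
  shows "e s = 0"
proof (rule Mnum_independent[OF _ s])
  fix u v :: "'a poly poly" assume "u \<in> span2" "v \<in> span2"
  then obtain a b c d where uv: "u = lin a b" "v = lin c d" by (metis span2_cases)
  show "(\<Sum>s=2..CARD('a). e s * sub (Mnum s) u v) = 0"
  proof (cases "a * d - b * c = 0")
    case True
    have "sub (Mnum s) u v = 0" for s
      using rhom_dvd[OF rhom_sub Mnum_L2_dvd[of s], of u v] by (simp add: uv sub_L2_lin True rhom_0[OF rhom_C2])
    then show ?thesis by simp
  next
    case False
    have "(\<Sum>s=2..CARD('a). e s * sub (Mnum s) u v) = (\<Sum>s=2..CARD('a). sub (e s) u v * sub (Mnum s) u v)"
    proof (rule sum.cong[OF refl])
      fix s assume "s \<in> {2..CARD('a)}"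
      then have "e s \<in> Inv" using e by (simp add: Inv_eq_D2)
      then show "e s * sub (Mnum s) u v = sub (e s) u v * sub (Mnum s) u v"
        by (simp add: uv InvD[OF _ False])
    qed
    also have "\<dots> = sub (\<Sum>s=2..CARD('a). e s * Mnum s) u v"
      by (simp only: rhom_sum[OF rhom_sub] rhom_mult[OF rhom_sub])
    also have "\<dots> = 0" by (simp add: 0 rhom_0[OF rhom_sub])
    finally show ?thesis .
  qed
qed

text \<open>Modulo a linear map, g / x2^Q is given on the span by the polynomial values -(h L2)(a
  x1, b x2). Interpolating these leaves only the denominator z^(q-1), and the linear map does not
  affect the coboundary.\<close>

lemma A2_difference_scaled_expansion:
  fixes f h :: "'a::{finite,field} poly poly"
  assumes f: "f \<in> A2 m" and h: "f - sub f (X1 + X2) X2 = X2 ^ (CARD('a) ^ m) * h"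
  shows "\<exists>p. \<forall>u\<in>span2. \<forall>v\<in>span2.
    (\<Sum>s=2..CARD('a). p s * sub (Mnum s) u v) = zf ^ (CARD('a) - 1) * sub (h * L2) u v"
proof -
  let ?q = "CARD('a)" and ?Q = "CARD('a) ^ m" and ?e = "\<lambda>s. s * (CARD('a) - 1) + 1"
  have q: "?q \<ge> 2" by (rule card_field_ge_2)
  define H where "H = h * L2"
  define g where "g u = sub (f * L2) u X2" for u
  define N where "N = (zf :: 'a poly poly) ^ (?q - 1)"
  have pl: "pluecker m (f * L2)" using f by (simp add: A2_iff)
  have g_scale: "g (C2 b * u) = C2 b * g u" for b u unfolding g_def by (rule pluecker_scale[OF pl refl])
  have g_X2: "g X2 = 0" unfolding g_def by (rule sub_mult_L2_same)
  have H: "X2 ^ ?Q * sub H u v = g u + g v - g (u + v)" if "u \<in> span2" "v \<in> span2" for u v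
    unfolding H_def g_def by (rule A2_coboundary[OF f h that])
  have X2Q: "X2 ^ ?Q \<noteq> (0 :: 'a poly poly)" using X2_nz[where 'a='a] by simp
  obtain P where P: "degree P < ?q ^ 2" "\<And>a b. poly P (lin a b) = N * sub (- H) (C2 a * X1) (C2 b * X2)"
    unfolding N_def using interpolation[of "- H"] by blast
  have poly_P: "X2 ^ ?Q * poly P (lin a b) = N * (g (lin a b) - C2 a * g X1)" for a b
  proof -
    have "C2 a * X1 \<in> span2" "C2 b * X2 \<in> span2"
      by (simp_all only: C2_X1_eq_lin C2_X2_eq_lin lin_in_span2)
    note * = H[OF this, unfolded g_scale g_X2, folded lin_def]
    have "X2 ^ ?Q * poly P (lin a b) = - (N * (X2 ^ ?Q * sub H (C2 a * X1) (C2 b * X2)))"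
      by (simp add: P(2) rhom_uminus[OF rhom_sub] mult.left_commute)
    also have "\<dots> = N * (g (lin a b) - C2 a * g X1)" unfolding * by (simp add: algebra_simps)
    finally show ?thesis .
  qed
  have scale: "poly P (C2 c * u) = C2 c * poly P u" if "u \<in> span2" for c u
  proof -
    from that obtain a b where u: "u = lin a b" by (rule span2_cases)
    have "X2 ^ ?Q * poly P (C2 c * u) = N * (g (C2 c * u) - C2 (c * a) * g X1)"
      unfolding u C2_mult_lin by (rule poly_P)
    also have "\<dots> = C2 c * (N * (g u - C2 a * g X1))"
      by (simp only: g_scale rhom_mult[OF rhom_C2]) (simp only: algebra_simps)
    also have "\<dots> = C2 c * (X2 ^ ?Q * poly P u)" unfolding u by (simp only: poly_P)
    also have "\<dots> = X2 ^ ?Q * (C2 c * poly P u)" by (rule mult.left_commute)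
    finally show ?thesis by (rule mult_left_cancel[OF X2Q, THEN iffD1])
  qed
  have add: "poly P u + poly P v - poly P (u + v) = N * sub H u v" if uv: "u \<in> span2" "v \<in> span2" for u v
  proof -
    from uv obtain a b c d where eq: "u = lin a b" "v = lin c d" by (metis span2_cases)
    have "X2 ^ ?Q * (poly P u + poly P v - poly P (u + v))
       = X2 ^ ?Q * poly P u + X2 ^ ?Q * poly P v - X2 ^ ?Q * poly P (u + v)"
      by (simp only: algebra_simps)
    also have "\<dots> = N * (g u - C2 a * g X1) + N * (g v - C2 c * g X1) - N * (g (u + v) - C2 (a + c) * g X1)"
      unfolding eq lin_add poly_P by (rule refl)
    also have "\<dots> = N * (g u + g v - g (u + v))"
      unfolding rhom_add[OF rhom_C2] by (simp add: algebra_simps)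
    also have "\<dots> = X2 ^ ?Q * (N * sub H u v)" unfolding H[OF uv, symmetric] by (rule mult.left_commute)
    finally show ?thesis by (rule mult_left_cancel[OF X2Q, THEN iffD1])
  qed
  note hom = homogeneous_poly[OF P(1) scale]
  define p where "p s = coeff P (?e s)" for s
  have split: "{..?q} = insert 0 (insert 1 {2..?q})" using q by auto
  show ?thesis
  proof (rule exI[of _ p], intro ballI)
    fix u v :: "'a poly poly" assume uv: "u \<in> span2" "v \<in> span2"
    have "N * sub H u v = (\<Sum>s\<le>?q. p s * u ^ ?e s) + (\<Sum>s\<le>?q. p s * v ^ ?e s) - (\<Sum>s\<le>?q. p s * (u + v) ^ ?e s)"
      unfolding add[OF uv, symmetric] p_def by (simp only: hom)
    also have "\<dots> = (\<Sum>s\<le>?q. p s * sub (Mnum s) u v)"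
      by (simp only: sub_Mnum right_diff_distrib distrib_left sum.distrib sum_subtractf)
    \<comment> \<open>The terms s = 0 and s = 1 belong to additive powers and drop out.\<close>
    also have "\<dots> = (\<Sum>s=2..?q. p s * sub (Mnum s) u v)"
      unfolding split by (simp add: sub_Mnum_0_1 sub_Mnum_0_1(2)[unfolded One_nat_def])
    finally show "(\<Sum>s=2..?q. p s * sub (Mnum s) u v) = zf ^ (?q - 1) * sub (h * L2) u v"
      unfolding N_def H_def by (rule sym)
  qed
qed

text \<open>Uniqueness makes each quotient p_s / z^(q-1) invariant. Multiplied by
  \<open>dickson2 0\<close> = x1^(q-1) z^(q-1) it is the polynomial x1^(q-1) p_s, an invariant
  vanishing on x1 = 0 and hence divisible by \<open>dickson2 0\<close>. So the quotient is a
  polynomial.\<close>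

lemma A2_difference_expansion:
  fixes f :: "'a::{finite,field} poly poly"
  assumes f: "f \<in> A2 m"
  shows "\<exists>c. (\<forall>s\<in>{2..CARD('a)}. c s \<in> D2) \<and>
    (f - sub f (X1 + X2) X2) * L2 = X2 ^ (CARD('a) ^ m) * (\<Sum>s=2..CARD('a). c s * Mnum s)"
proof -
  let ?q = "CARD('a)"
  define I where "I = {2..?q}"
  have q: "?q \<ge> 2" by (rule card_field_ge_2)
  obtain h where h: "f - sub f (X1 + X2) X2 = X2 ^ (?q ^ m) * h"
    using A2_difference_dvd[OF f] by (auto simp: dvd_def)
  define H where "H = h * L2"
  define N where "N = (zf :: 'a poly poly) ^ (?q - 1)"
  from A2_difference_scaled_expansion[OF f h] obtain p
    where "\<forall>u\<in>span2. \<forall>v\<in>span2. (\<Sum>s=2..?q. p s * sub (Mnum s) u v) = zf ^ (?q - 1) * sub (h * L2) u v" ..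
  then have p: "(\<Sum>s\<in>I. p s * sub (Mnum s) u v) = N * sub H u v" if "u \<in> span2" "v \<in> span2" for u v
    using that unfolding N_def H_def I_def by blast
  have N_nz: "N \<noteq> 0" using zf_nz[where 'a='a] by (simp add: N_def)
  have Q0: "X1 ^ (?q - 1) * N = (dickson2 0 :: 'a poly poly)"
    by (simp only: N_def dickson2_0 L2_eq_zf power_mult_distrib)
  have Q0_nz: "dickson2 0 \<noteq> (0 :: 'a poly poly)" using L2_nz[where 'a='a] by (simp add: dickson2_0)
  \<comment> \<open>Invariance of p_s / N with denominators cleared: the original expansion and its
    transform under the substitution are compared on the span.\<close>
  have cross: "N * sub (p s) (lin a b) (lin c d) = sub N (lin a b) (lin c d) * p s"
    if det: "a * d - b * c \<noteq> 0" and s: "s \<in> I" for a b c d s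
  proof -
    let ?\<sigma> = "\<lambda>r. sub r (lin a b) (lin c d)"
    have "N * ?\<sigma> (p s) - ?\<sigma> N * p s = 0"
    proof (rule Mnum_independent[of "\<lambda>s. N * ?\<sigma> (p s) - ?\<sigma> N * p s"])
      fix u v :: "'a poly poly" assume uv: "u \<in> span2" "v \<in> span2"
      then have "u \<in> ?\<sigma> ` span2" "v \<in> ?\<sigma> ` span2"
        unfolding bij_betw_imp_surj_on[OF bij_betw_span2[OF det]] by simp_all
      then obtain u' v' where u': "u' \<in> span2" "u = ?\<sigma> u'" and v': "v' \<in> span2" "v = ?\<sigma> v'"
        by (elim imageE)
      have "?\<sigma> (\<Sum>s\<in>I. p s * sub (Mnum s) u' v') = ?\<sigma> (N * sub H u' v')"
        by (simp only: p[OF u'(1) v'(1)])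
      then have "(\<Sum>s\<in>I. ?\<sigma> (p s) * sub (Mnum s) u v) = ?\<sigma> N * sub H u v"
        by (simp only: rhom_sum[OF rhom_sub] rhom_mult[OF rhom_sub] sub_sub u' v')
      then have "N * (\<Sum>s\<in>I. ?\<sigma> (p s) * sub (Mnum s) u v) = ?\<sigma> N * (N * sub H u v)"
        by (simp only: mult.left_commute)
      also have "\<dots> = ?\<sigma> N * (\<Sum>s\<in>I. p s * sub (Mnum s) u v)" by (simp only: p[OF uv])
      finally show "(\<Sum>s=2..?q. (N * ?\<sigma> (p s) - ?\<sigma> N * p s) * sub (Mnum s) u v) = 0"
        unfolding I_def by (simp only: left_diff_distrib sum_subtractf sum_distrib_left mult.assoc right_minus_eq)
    qed (use s in \<open>simp add: I_def\<close>)
    then show ?thesis by simp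
  qed
  have "\<forall>s\<in>I. \<exists>c. c \<in> Inv \<and> p s = N * c"
  proof (rule ballI)
    fix s assume s: "s \<in> I"
    define x where "x = (X1 :: 'a poly poly) ^ (?q - 1)"
    have inv: "x * p s \<in> Inv"
    proof (rule InvI)
      fix a b c d :: 'a assume det: "a * d - b * c \<noteq> 0"
      let ?\<sigma> = "\<lambda>r. sub r (lin a b) (lin c d)"
      have "dickson2 0 * ?\<sigma> (x * p s) = ?\<sigma> x * x * (N * ?\<sigma> (p s))"
        by (simp only: Q0[symmetric] x_def[symmetric] rhom_mult[OF rhom_sub] mult_ac)
      also have "\<dots> = ?\<sigma> (x * N) * (x * p s)"
        by (simp only: cross[OF det s] rhom_mult[OF rhom_sub] mult_ac)
      also have "?\<sigma> (x * N) = dickson2 0" unfolding x_def Q0 by (rule InvD[OF dickson2_in_Inv det])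
      finally show "?\<sigma> (x * p s) = x * p s" by (rule mult_left_cancel[OF Q0_nz, THEN iffD1])
    qed
    have "?q - 1 \<noteq> 0" using q by linarith
    then have "sub (x * p s) 0 X2 = 0"
      by (simp only: x_def rhom_mult[OF rhom_sub] rhom_power[OF rhom_sub] ev2_X1[OF rhom_C2] power_0_left if_False mult_zero_left)
    then have "dickson2 0 dvd x * p s" unfolding dickson2_0 by (rule Inv_dvd[OF inv])
    then obtain c where c: "x * p s = dickson2 0 * c" by (auto simp: dvd_def)
    then have "x * p s = x * (N * c)" by (simp only: Q0[symmetric] x_def mult.assoc)
    moreover have "x \<noteq> 0" using X1_nz[where 'a='a] by (simp add: x_def)
    ultimately have "p s = N * c" by simp
    moreover have "c \<in> Inv" using inv unfolding c by (rule Inv_cancel[OF _ dickson2_in_Inv Q0_nz])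
    ultimately show "\<exists>c. c \<in> Inv \<and> p s = N * c" by (intro exI[of _ c] conjI)
  qed
  from bchoice[OF this] obtain c where c: "\<forall>s\<in>I. c s \<in> Inv \<and> p s = N * c s"
    by (elim exE)
  have "(\<Sum>s\<in>I. p s * Mnum s) = (\<Sum>s\<in>I. N * c s * Mnum s)"
  proof (rule sum.cong[OF refl])
    fix s assume "s \<in> I"
    then have "p s = N * c s" using c by blast
    then show "p s * Mnum s = N * c s * Mnum s" by (rule arg_cong)
  qed
  then have "N * (\<Sum>s\<in>I. c s * Mnum s) = (\<Sum>s\<in>I. p s * Mnum s)"
    by (simp only: sum_distrib_left mult.assoc)
  also have "\<dots> = N * H" using p[OF X1_in_span2 X2_in_span2] by (simp only: sub_X1_X2)
  finally have "(\<Sum>s\<in>I. c s * Mnum s) = H" by (rule mult_left_cancel[OF N_nz, THEN iffD1])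
  then have "(f - sub f (X1 + X2) X2) * L2 = X2 ^ (?q ^ m) * (\<Sum>s=2..?q. c s * Mnum s)"
    unfolding h I_def H_def by (simp only: mult.assoc)
  moreover have "\<forall>s\<in>{2..?q}. c s \<in> D2" using c by (simp add: I_def Inv_eq_D2)
  ultimately show ?thesis by (intro exI conjI)
qed

section \<open>Delta operators on powers\<close>

lemma delta2_num_eq:
  "delta2_num m ([:0, 1:] ^ k :: 'a::{finite,field} poly) =
     X1 ^ (k + 1) * X2 ^ (CARD('a) ^ m) - X2 ^ (k + 1) * X1 ^ (CARD('a) ^ m)"
proof -
  have "ev1 C2 ([:0, 1:] ^ k :: 'a poly) x = x ^ k" for x
    by (simp only: rhom_power[OF rhom_ev1[OF rhom_C2]] ev1_X[OF rhom_C2])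
  then show ?thesis by (simp add: delta2_num_def det2_def mult_ac)
qed

text \<open>On x2 = b x1 both terms acquire the same factor b, since s(q-1)+1 and q^m are exponents
  fixing every scalar.\<close>

lemma delta2_num_dvd:
  "L2 dvd delta2_num m ([:0, 1:] ^ (s * (CARD('a) - 1)) :: 'a::{finite,field} poly)"
proof (rule L2_dvd)
  let ?e = "s * (CARD('a) - 1) + 1"
  show "sub (delta2_num m ([:0, 1:] ^ (s * (CARD('a) - 1)) :: 'a poly)) 0 X2 = 0"
    unfolding delta2_num_eq by (simp add: sub_simps power_0_left)
  fix b :: 'a
  have "C2 b ^ ?e = C2 b"
    by (simp only: rhom_power[OF rhom_C2, symmetric] power_mult_card_minus_1)
  then show "sub (delta2_num m ([:0, 1:] ^ (s * (CARD('a) - 1)) :: 'a poly)) X1 (C2 b * X1) = 0"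
    unfolding delta2_num_eq
    by (simp only: sub_simps power_mult_distrib C2_power_card_power) (simp add: mult_ac)
qed

definition delta2_pow :: "nat \<Rightarrow> nat \<Rightarrow> 'a::{finite,field} poly poly" where
  "delta2_pow m s = delta2 m ([:0, 1:] ^ (s * (CARD('a) - 1)))"

lemma delta2_pow_mult_L2:
  "delta2_pow m s * L2 = X1 ^ (s * (CARD('a) - 1) + 1) * X2 ^ (CARD('a) ^ m)
     - X2 ^ (s * (CARD('a) - 1) + 1) * (X1 :: 'a::{finite,field} poly poly) ^ (CARD('a) ^ m)"
  unfolding delta2_pow_def delta2_def using delta2_num_dvd[of m s, where 'a='a] by (simp add: delta2_num_eq)

text \<open>A function of the form v^Q G(u) - u^Q G(v) satisfies the three-term relation
  identically.\<close>

lemma delta2_pow_in_A2: "delta2_pow m s \<in> A2 m"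
  unfolding A2_iff delta2_pow_mult_L2 pluecker_def sub_simps by (simp add: algebra_simps)

lemma delta2_pow_difference:
  "(delta2_pow m s - sub (delta2_pow m s) (X1 + X2) X2) * L2 = X2 ^ (CARD('a) ^ m) * (Mnum s :: 'a::{finite,field} poly poly)"
proof -
  have "sub (delta2_pow m s) (X1 + X2) X2 * L2 = sub (delta2_pow m s * L2) (X1 + X2) (X2 :: 'a poly poly)"
    by (simp only: rhom_mult[OF rhom_sub] sub_L2_X1_plus_X2)
  then have "(delta2_pow m s - sub (delta2_pow m s) (X1 + X2) X2) * L2 = delta2_pow m s * L2 - sub (delta2_pow m s * L2) (X1 + X2) (X2 :: 'a poly poly)"
    by (simp only: left_diff_distrib)
  also have "\<dots> = X2 ^ (CARD('a) ^ m) * Mnum s"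
    unfolding delta2_pow_mult_L2 sub_simps frobenius_add_power[OF rhom_C2] Mnum_def by (simp add: algebra_simps)
  finally show ?thesis .
qed

section \<open>The two bases\<close>

lemma atLeastAtMost_1_card: "{1..CARD('a::{finite,field})} = insert 1 {2..CARD('a)}"
  using card_field_ge_2[where 'a='a] by auto

text \<open>Coefficients in \<open>D2\<close> are fixed by x1 -> x1 + x2, so the difference map is
  linear over \<open>D2\<close>.\<close>

lemma delta2_pow_sum_difference:
  fixes c :: "nat \<Rightarrow> 'a::{finite,field} poly poly"
  assumes c: "\<And>s. s \<in> {2..CARD('a)} \<Longrightarrow> c s \<in> D2"
  shows "((\<Sum>s=2..CARD('a). c s * delta2_pow m s) - sub (\<Sum>s=2..CARD('a). c s * delta2_pow m s) (X1 + X2) X2) * L2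
    = X2 ^ (CARD('a) ^ m) * (\<Sum>s=2..CARD('a). c s * Mnum s)"
proof -
  let ?q = "CARD('a)" and ?T = "\<lambda>f :: 'a poly poly. (f - sub f (X1 + X2) X2) * L2"
  have "?T (\<Sum>s=2..?q. c s * delta2_pow m s) = (\<Sum>s=2..?q. ?T (c s * delta2_pow m s))"
    by (simp only: rhom_sum[OF rhom_sub] sum_subtractf[symmetric] sum_distrib_right)
  also have "\<dots> = (\<Sum>s=2..?q. c s * (X2 ^ (?q ^ m) * Mnum s))"
  proof (rule sum.cong[OF refl])
    fix s assume "s \<in> {2..?q}"
    then have "sub (c s) (X1 + X2) X2 = c s" using c by (intro Inv_sub_X1_plus_X2) (simp add: Inv_eq_D2)
    then have "?T (c s * delta2_pow m s) = c s * ?T (delta2_pow m s)"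
      by (simp only: rhom_mult[OF rhom_sub] right_diff_distrib[symmetric] mult.assoc)
    then show "?T (c s * delta2_pow m s) = c s * (X2 ^ (?q ^ m) * Mnum s)" by (simp only: delta2_pow_difference)
  qed
  finally show ?thesis by (simp only: sum_distrib_left mult.left_commute)
qed

text \<open>Index 1 carries the basis element 1. Generation: subtracting the combination of deltas
  with the same difference leaves an element of the kernel \<open>D2\<close>. Independence: the
  difference map removes the multiple of 1 and leads to a relation among the
  \<open>Mnum s\<close>.\<close>

lemma A2_free_basis:
  "D2_free_basis (A2 m :: 'a::{finite,field} poly poly set) {1..CARD('a)} (\<lambda>s. if s = 1 then 1 else delta2_pow m s)"
proof -
  let ?q = "CARD('a)" and ?T = "\<lambda>f :: 'a poly poly. (f - sub f (X1 + X2) X2) * L2"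
  let ?B = "\<lambda>s. if s = 1 then 1 else delta2_pow m s :: 'a poly poly"
  have X2Q: "X2 ^ (?q ^ m) \<noteq> (0 :: 'a poly poly)" using X2_nz[where 'a='a] by simp
  have sum_B: "(\<Sum>s=1..?q. c s * ?B s) = c 1 + (\<Sum>s=2..?q. c s * delta2_pow m s)" for c
    unfolding atLeastAtMost_1_card by (simp add: sum.insert)
  have "f \<in> A2 m \<longleftrightarrow> f \<in> {\<Sum>s=1..?q. c s * ?B s | c. \<forall>s\<in>{1..?q}. c s \<in> D2}" for f
  proof
    assume f: "f \<in> A2 m"
    from A2_difference_expansion[OF f] obtain c where c: "\<forall>s\<in>{2..?q}. c s \<in> D2"
        "?T f = X2 ^ (?q ^ m) * (\<Sum>s=2..?q. c s * Mnum s)"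
      by (elim exE conjE)
    define r where "r = (\<Sum>s=2..?q. c s * delta2_pow m s)"
    have "f + (\<Sum>s=2..?q. (0 - c s) * delta2_pow m s) \<in> A2 m"
      by (intro A2_add[OF f] A2_sum A2_D2_mult delta2_pow_in_A2 D2_diff D2_0 bspec[OF c(1)])
    moreover have "f + (\<Sum>s=2..?q. (0 - c s) * delta2_pow m s) = f - r" by (simp add: r_def sum_negf)
    ultimately have fr: "f - r \<in> A2 m" by simp
    have "?T (f - r) = ?T f - ?T r" by (simp add: rhom_diff[OF rhom_sub] algebra_simps)
    also have "?T r = ?T f"
      unfolding r_def c(2) by (rule delta2_pow_sum_difference) (rule bspec[OF c(1)])
    also have "?T f - ?T f = 0" by (rule diff_self)
    finally have "sub (f - r) (X1 + X2) X2 = f - r" using L2_nz[where 'a='a] by simp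
    then have "f - r \<in> D2" using A2_Inv[OF fr] by (simp add: Inv_eq_D2)
    then have "\<forall>s\<in>{1..?q}. (if s = 1 then f - r else c s) \<in> D2" using c(1) by auto
    moreover have "f = (\<Sum>s=1..?q. (if s = 1 then f - r else c s) * ?B s)"
      unfolding sum_B by (simp add: r_def)
    ultimately show "f \<in> {\<Sum>s=1..?q. c s * ?B s | c. \<forall>s\<in>{1..?q}. c s \<in> D2}"
      unfolding mem_Collect_eq by (intro exI[of _ "\<lambda>s. if s = 1 then f - r else c s"] conjI)
  next
    assume "f \<in> {\<Sum>s=1..?q. c s * ?B s | c. \<forall>s\<in>{1..?q}. c s \<in> D2}"
    then obtain c where c: "f = (\<Sum>s=1..?q. c s * ?B s)" "\<forall>s\<in>{1..?q}. c s \<in> D2"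
      unfolding mem_Collect_eq by (elim exE conjE)
    have "?B s \<in> A2 m" for s by (simp add: one_in_A2 delta2_pow_in_A2)
    then show "f \<in> A2 m" unfolding c(1) using c(2) by (intro A2_sum A2_D2_mult) auto
  qed
  moreover have "c s = c' s"
    if D: "\<forall>s\<in>{1..?q}. c s \<in> D2 \<and> c' s \<in> D2" and eq: "(\<Sum>s=1..?q. c s * ?B s) = (\<Sum>s=1..?q. c' s * ?B s)"
      and s: "s \<in> {1..?q}" for c c' s
  proof -
    define d where "d s = c s - c' s" for s
    have d: "d s \<in> D2" if "s \<in> {1..?q}" for s using D that by (simp add: d_def D2_diff)
    have d2: "d s \<in> D2" if "s \<in> {2..?q}" for s using d that by simp
    have "(\<Sum>s=1..?q. d s * ?B s) = 0"
      unfolding d_def left_diff_distrib sum_subtractf eq by simp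
    then have 0: "d 1 + (\<Sum>s=2..?q. d s * delta2_pow m s) = 0" by (simp only: sum_B)
    have d1: "sub (d 1) (X1 + X2) X2 = d 1"
      using d[of 1] card_field_ge_2[where 'a='a] by (intro Inv_sub_X1_plus_X2) (simp add: Inv_eq_D2)
    have "X2 ^ (?q ^ m) * (\<Sum>s=2..?q. d s * Mnum s) = ?T (\<Sum>s=2..?q. d s * delta2_pow m s)"
      by (rule delta2_pow_sum_difference[OF d2, symmetric])
    also have "(\<Sum>s=2..?q. d s * delta2_pow m s) = - d 1" using 0 by (simp only: eq_neg_iff_add_eq_0 add.commute)
    also have "?T (- d 1) = 0" by (simp only: rhom_uminus[OF rhom_sub] d1 diff_self mult_zero_left)
    finally have "X2 ^ (?q ^ m) * (\<Sum>s=2..?q. d s * Mnum s) = 0" .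
    then have "(\<Sum>s=2..?q. d s * Mnum s) = 0" using X2Q by simp
    then have d20: "d s = 0" if "s \<in> {2..?q}" for s using Mnum_independent_D2[OF d2 _ that] by simp
    then have "(\<Sum>s=2..?q. d s * delta2_pow m s) = 0" by (intro sum.neutral ballI) simp
    then have "d 1 = 0" using 0 by simp
    then have "d s = 0" using d20[of s] s by (cases "s = 1") auto
    then show ?thesis by (simp add: d_def)
  qed
  ultimately show ?thesis unfolding D2_free_basis_def by (intro conjI set_eqI allI impI ballI) (simp_all only: finite_atLeastAtMost)
qed

text \<open>The right-hand side does not mention \<open>m\<close>, which gives the independence of
  \<open>m\<close>. Every combination is attained, by the same combination of deltas.\<close>

lemma Mset_eq:
  "Mset m = {\<Sum>s=2..CARD('a). c s * (Mnum s div L2) | c. \<forall>s\<in>{2..CARD('a)}. c s \<in> (D2 :: 'a::{finite,field} poly poly set)}"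
  (is "_ = ?S")
proof -
  let ?q = "CARD('a)" and ?T = "\<lambda>f :: 'a poly poly. f - sub f (X1 + X2) X2"
  have Mnum: "Mnum s div L2 * L2 = (Mnum s :: 'a poly poly)" for s
    using Mnum_L2_dvd[of s, where 'a='a] by simp
  have quot: "?T f div X2 ^ (?q ^ m) = (\<Sum>s=2..?q. c s * (Mnum s div L2))"
    if "?T f * L2 = X2 ^ (?q ^ m) * (\<Sum>s=2..?q. c s * Mnum s)" for f c
  proof -
    have "(\<Sum>s=2..?q. c s * Mnum s) = (\<Sum>s=2..?q. c s * (Mnum s div L2)) * L2"
      by (simp only: sum_distrib_right mult.assoc Mnum)
    then have "?T f * L2 = (X2 ^ (?q ^ m) * (\<Sum>s=2..?q. c s * (Mnum s div L2))) * L2"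
      using that by (simp only: mult.assoc)
    then have "?T f = X2 ^ (?q ^ m) * (\<Sum>s=2..?q. c s * (Mnum s div L2))"
      by (rule mult_right_cancel[OF L2_nz, THEN iffD1])
    then show ?thesis using X2_nz[where 'a='a] by simp
  qed
  show ?thesis
  proof (intro set_eqI iffI)
    fix h :: "'a poly poly" assume "h \<in> Mset m"
    then obtain f where f: "f \<in> A2 m" "h = ?T f div X2 ^ (?q ^ m)" by (auto simp: Mset_def)
    from A2_difference_expansion[OF f(1)] obtain c where c: "\<forall>s\<in>{2..?q}. c s \<in> D2"
        "?T f * L2 = X2 ^ (?q ^ m) * (\<Sum>s=2..?q. c s * Mnum s)"
      by (elim exE conjE)
    show "h \<in> ?S" unfolding f(2) quot[OF c(2)] mem_Collect_eq using c(1) by (intro exI[of _ c] conjI refl)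
  next
    fix h :: "'a poly poly" assume "h \<in> ?S"
    then obtain c where c: "h = (\<Sum>s=2..?q. c s * (Mnum s div L2))" "\<forall>s\<in>{2..?q}. c s \<in> D2"
      unfolding mem_Collect_eq by (elim exE conjE)
    define f where "f = (\<Sum>s=2..?q. c s * delta2_pow m s)"
    have "f \<in> A2 m" unfolding f_def using c(2) by (intro A2_sum A2_D2_mult delta2_pow_in_A2) auto
    moreover have "h = ?T f div X2 ^ (?q ^ m)"
      unfolding c(1) f_def by (rule quot[OF delta2_pow_sum_difference, symmetric]) (use c(2) in blast)
    ultimately show "h \<in> Mset m" by (auto simp: Mset_def)
  qed
qed

lemma Mset_free_basis:
  "D2_free_basis (Mset m :: 'a::{finite,field} poly poly set) {2..CARD('a)} (\<lambda>s. Mnum s div L2)"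
proof -
  let ?q = "CARD('a)"
  have "c s = c' s"
    if D: "\<forall>s\<in>{2..?q}. c s \<in> D2 \<and> c' s \<in> D2"
      and eq: "(\<Sum>s=2..?q. c s * (Mnum s div L2)) = (\<Sum>s=2..?q. c' s * (Mnum s div L2))"
      and s: "s \<in> {2..?q}" for c c' :: "nat \<Rightarrow> 'a poly poly" and s
  proof -
    have Mnum: "Mnum s div L2 * L2 = (Mnum s :: 'a poly poly)" for s
      using Mnum_L2_dvd[of s, where 'a='a] by simp
    have "(\<Sum>s=2..?q. (c s - c' s) * Mnum s) = (\<Sum>s=2..?q. (c s - c' s) * (Mnum s div L2)) * L2"
      by (simp only: sum_distrib_right mult.assoc Mnum)
    also have "\<dots> = 0" unfolding left_diff_distrib sum_subtractf eq by simp
    finally have "c s - c' s = 0"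
      by (rule Mnum_independent_D2[OF _ _ s, rotated]) (use D in \<open>auto intro: D2_diff\<close>)
    then show ?thesis by simp
  qed
  then show ?thesis unfolding D2_free_basis_def Mset_eq by (intro conjI refl allI impI ballI) (simp_all only: finite_atLeastAtMost)
qed

text \<open>The divisibility claims accompany the bases because the quotients are written with
  \<open>div\<close>; they certify that each division is exact.\<close>

theorem mainTheorem14:
  fixes m :: nat
  shows "(\<forall>s\<in>{2..CARD('a)}. (L2 :: 'a::{finite,field} poly poly) dvd delta2_num m ([:0, 1:] ^ (s * (CARD('a) - 1))))
    \<and> D2_free_basis (A2 m :: 'a poly poly set) {1..CARD('a)}
        (\<lambda>s. if s = 1 then 1 else delta2 m ([:0, 1:] ^ (s * (CARD('a) - 1))))
    \<and> (\<forall>f\<in>(A2 m :: 'a poly poly set). X2 ^ (CARD('a) ^ m) dvd f - ev2 C2 f (X1 + X2) X2)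
    \<and> (\<forall>m'. (Mset m' :: 'a poly poly set) = Mset m)
    \<and> (\<forall>s\<in>{2..CARD('a)}. (L2 :: 'a poly poly) dvd Mnum s)
    \<and> D2_free_basis (Mset m :: 'a poly poly set) {2..CARD('a)} (\<lambda>s. Mnum s div L2)"
proof (intro conjI ballI allI)
  show "Mset m' = (Mset m :: 'a poly poly set)" for m' by (simp only: Mset_eq)
qed (simp_all only: delta2_num_dvd A2_free_basis[unfolded delta2_pow_def] A2_difference_dvd Mnum_L2_dvd Mset_free_basis)

end
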